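(* The only orientable ribbon graphs $G$ having a non-constant partial-dual genus polynomial ${}^{\partial}\Gamma_G(z)=\sum_{A\subseteq E(G)} z^{g(G^A)}$ with only one non-zero coefficient are partial duals of ribbon-joins of $B_n$'s with $n$ odd.
   Context: A ribbon graph $G$ is a surface with boundary represented as the union of two sets of closed topological discs, vertex-discs $V(G)$ and edge-ribbons $E(G)$, such that: vertex-discs and edge-ribbons intersect in disjoint line segments; each such segment lies on the boundary of precisely one vertex-disc and precisely one edge-ribbon; every edge-ribbon contains exactly two such segments. (So each edge-ribbon is a rectangle attached to vertex-discs along two opposite sides.) Gluing a disc (face-disc) to each boundary component gives a closed surface $\Sigma_G$. For orientable $G$, the genus $g(G)$ is the orientable genus of $\Sigma_G$, namely half its Euler genus; for connected $G$ this means $2-2g(G)=|V(G)|-|E(G)|+(\text{number of face-discs})$. Partial dual: for $A\subseteq E(G)$, the partial dual $G^A$ is the ribbon graph whose vertex-discs are discs bounded by the boundary components of the spanning ribbon subgraph of $G$ with all vertices of $G$ and only the edges in $A$. Edge-ribbons in $E(G)\setminus A$ are attached to these new vertex-discs at exactly the same places as in $G$. For $e\in A$, a copy $e'$ of the rectangle $e$ is attached to the new vertex-discs along the pair of opposite sides of $e$ by which $e$ was not attached to vertex-discs of $G$ (these sides are arcs of the boundary of the spanning subgraph); the copies of the other pair of sides become arcs of the boundary of $G^A$. Ribbon-join: $G_1\vee G_2$ denotes any ribbon graph obtained from ribbon graphs $G_1,G_2$ by gluing a vertex-disc of $G_1$ to a vertex-disc of $G_2$ along an arc of the boundary of each, each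 arc lying between consecutive ends of edge-ribbons, so that the two vertex-discs become one vertex-disc. The result depends on the choice of vertex-discs and arcs. A ribbon-join of several ribbon graphs is obtained by iterating this operation. $B_n$ is the one-vertex orientable ribbon graph with $n$ edge-ribbons every two of which are interlaced, i.e. their ends alternate along the boundary circle of the vertex-disc.
   Formalization: G is assumed connected: without this the claim fails, since the disjoint union of two copies of B_3 has polynomial 64z^2 but is not a partial dual of a ribbon-join of B_n's, all of which are connected. *)

theory Defs
  imports Main "HOL-Computational_Algebra.Polynomial"
begin

text \<open>
  Ribbon graphs, up to homeomorphism, are encoded by their flags: the corners of the
  edge-ribbons, four per ribbon.  The boundaries of the vertex-discs and edge-ribbons are cut by
  the flags into three kinds of curves, each joining two flags, and so give three fixed-point free
  involutions: \<open>tau_end\<close> follows the segment along which an edge-ribbon is attached to a vertex-disc,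
  \<open>tau_side\<close> follows a free side of an edge-ribbon, and \<open>tau_arc\<close> follows the arc of the boundary
  of a vertex-disc between two consecutive ends of edge-ribbons (it may coincide with \<open>tau_end\<close> or
  \<open>tau_side\<close> at some flags).  Vertex-discs without edge-ribbons carry no flags and are only
  counted.  The values of the involutions outside the flags are irrelevant.
\<close>

record 'a ribbon_graph =
  flags :: "'a set"
  tau_end :: "'a \<Rightarrow> 'a"
  tau_side :: "'a \<Rightarrow> 'a"
  tau_arc :: "'a \<Rightarrow> 'a"
  isolated :: nat

definition fpf_involution_on :: "'a set \<Rightarrow> ('a \<Rightarrow> 'a) \<Rightarrow> bool" where
  "fpf_involution_on X t \<longleftrightarrow> (\<forall>x\<in>X. t x \<in> X \<and> t x \<noteq> x \<and> t (t x) = x)"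

text \<open>The last two conditions say that an edge-ribbon is a rectangle with four distinct corners.\<close>

definition is_ribbon_graph :: "'a ribbon_graph \<Rightarrow> bool" where
  "is_ribbon_graph G \<longleftrightarrow>
     finite (flags G) \<and>
     fpf_involution_on (flags G) (tau_end G) \<and>
     fpf_involution_on (flags G) (tau_side G) \<and>
     fpf_involution_on (flags G) (tau_arc G) \<and>
     (\<forall>x\<in>flags G. tau_end G (tau_side G x) = tau_side G (tau_end G x)) \<and>
     (\<forall>x\<in>flags G. tau_end G x \<noteq> tau_side G x)"

definition reach :: "('a \<Rightarrow> 'a) set \<Rightarrow> 'a set \<Rightarrow> ('a \<times> 'a) set" where
  "reach T X = {(x, t x) | x t. t \<in> T \<and> x \<in> X \<and> t x \<in> X}\<^sup>*"

definition orbits :: "('a \<Rightarrow> 'a) set \<Rightarrow> 'a set \<Rightarrow> 'a set set" where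
  "orbits T X = X // reach T X"

definition edges :: "'a ribbon_graph \<Rightarrow> 'a set set" where
  "edges G = orbits {tau_end G, tau_side G} (flags G)"

definition num_vertices :: "'a ribbon_graph \<Rightarrow> nat" where
  "num_vertices G = card (orbits {tau_end G, tau_arc G} (flags G)) + isolated G"

text \<open>Face-discs correspond to boundary components, which consist of free sides and arcs;
  an isolated vertex-disc has one boundary component.\<close>

definition num_faces :: "'a ribbon_graph \<Rightarrow> nat" where
  "num_faces G = card (orbits {tau_side G, tau_arc G} (flags G)) + isolated G"

definition num_components :: "'a ribbon_graph \<Rightarrow> nat" where
  "num_components G =
     card (orbits {tau_end G, tau_side G, tau_arc G} (flags G)) + isolated G"

definition connected_rg :: "'a ribbon_graph \<Rightarrow> bool" where
  "connected_rg G \<longleftrightarrow> num_components G = 1"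

text \<open>Coherent orientations of all vertex-discs and edge-ribbons amount to the following sign at
  the flags: whether the oriented boundary of the vertex-disc passes, at that flag, from an arc
  to an attaching segment or vice versa.  Coherence along the attaching segments says that
  opposite signs occur at the two ends of each free side.\<close>

definition orientable_rg :: "'a ribbon_graph \<Rightarrow> bool" where
  "orientable_rg G \<longleftrightarrow>
     (\<exists>c :: 'a \<Rightarrow> bool. \<forall>x\<in>flags G.
        c (tau_end G x) \<noteq> c x \<and> c (tau_side G x) \<noteq> c x \<and> c (tau_arc G x) \<noteq> c x)"

definition euler_genus :: "'a ribbon_graph \<Rightarrow> int" where
  "euler_genus G = 2 * int (num_components G)
     - (int (num_vertices G) - int (card (edges G)) + int (num_faces G))"

text \<open>Meaningful for orientable ribbon graphs, whose Euler genus is even.\<close>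

definition genus :: "'a ribbon_graph \<Rightarrow> nat" where
  "genus G = nat (euler_genus G div 2)"

definition ribbon_iso :: "'a ribbon_graph \<Rightarrow> 'b ribbon_graph \<Rightarrow> bool"  (infix "\<cong>\<^sub>r" 50) where
  "G \<cong>\<^sub>r H \<longleftrightarrow> isolated G = isolated H \<and>
     (\<exists>f. bij_betw f (flags G) (flags H) \<and>
        (\<forall>x\<in>flags G. f (tau_end G x) = tau_end H (f x) \<and>
                     f (tau_side G x) = tau_side H (f x) \<and>
                     f (tau_arc G x) = tau_arc H (f x)))"

text \<open>The boundary of the spanning subgraph with edges \<open>A\<close> follows the free sides of the ribbons
  in \<open>A\<close> and the attaching segments of the others.  So the two kinds of sides of a ribbon are
  exchanged exactly when it is in \<open>A\<close>.\<close>

definition partial_dual :: "'a ribbon_graph \<Rightarrow> 'a set set \<Rightarrow> 'a ribbon_graph" where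
  "partial_dual G A =
     \<lparr>flags = flags G,
      tau_end = (\<lambda>x. if x \<in> \<Union>A then tau_side G x else tau_end G x),
      tau_side = (\<lambda>x. if x \<in> \<Union>A then tau_end G x else tau_side G x),
      tau_arc = tau_arc G,
      isolated = isolated G\<rparr>"

definition partial_dual_genus_poly :: "'a ribbon_graph \<Rightarrow> int poly" where
  "partial_dual_genus_poly G = (\<Sum>A\<in>Pow (edges G). monom 1 (genus (partial_dual G A)))"

definition disjoint_union_rg :: "'a ribbon_graph \<Rightarrow> 'a ribbon_graph \<Rightarrow> 'a ribbon_graph" where
  "disjoint_union_rg G H =
     \<lparr>flags = flags G \<union> flags H,
      tau_end = (\<lambda>z. if z \<in> flags G then tau_end G z else tau_end H z),
      tau_side = (\<lambda>z. if z \<in> flags G then tau_side G z else tau_side H z),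
      tau_arc = (\<lambda>z. if z \<in> flags G then tau_arc G z else tau_arc H z),
      isolated = isolated G + isolated H\<rparr>"

text \<open>Gluing an inner part of the arc between \<open>x\<close> and \<open>x'\<close> to an inner part of the arc between \<open>y\<close>
  and \<open>y'\<close> leaves two arcs, one between \<open>x\<close> and \<open>y\<close> and one between \<open>x'\<close> and \<open>y'\<close>.  The other way
  of identifying the two arcs is obtained from \<open>x\<close> and \<open>y'\<close>.\<close>

definition glue_arcs ::
  "'a ribbon_graph \<Rightarrow> 'a \<Rightarrow> 'a ribbon_graph \<Rightarrow> 'a \<Rightarrow> 'a ribbon_graph" where
  "glue_arcs G x H y =
     (let U = disjoint_union_rg G H; x' = tau_arc G x; y' = tau_arc H y
      in U\<lparr>tau_arc := (tau_arc U)(x := y, y := x, x' := y', y' := x')\<rparr>)"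

text \<open>\<open>ribbon_join G H K\<close>: \<open>K\<close> is a ribbon-join of \<open>G\<close> and \<open>H\<close>, given on disjoint sets of flags.
  Gluing an isolated vertex-disc to a vertex-disc creates no new arcs.\<close>

inductive ribbon_join :: "'a ribbon_graph \<Rightarrow> 'a ribbon_graph \<Rightarrow> 'a ribbon_graph \<Rightarrow> bool" where
  arcs: "\<lbrakk>flags G \<inter> flags H = {}; x \<in> flags G; y \<in> flags H\<rbrakk>
    \<Longrightarrow> ribbon_join G H (glue_arcs G x H y)"
| disc: "\<lbrakk>flags G \<inter> flags H = {}; num_vertices G > 0; num_vertices H > 0;
     isolated G > 0 \<or> isolated H > 0\<rbrakk>
    \<Longrightarrow> ribbon_join G H
          ((disjoint_union_rg G H)\<lparr>isolated := isolated G + isolated H - 1\<rparr>)"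

text \<open>The ribbon-joins of one or more members of the class \<open>S\<close>.\<close>

inductive_set ribbon_joins_of :: "'a ribbon_graph set \<Rightarrow> 'a ribbon_graph set"
  for S :: "'a ribbon_graph set" where
  base: "G \<in> S \<Longrightarrow> G \<in> ribbon_joins_of S"
| join: "\<lbrakk>G \<in> ribbon_joins_of S; H \<in> ribbon_joins_of S; ribbon_join G H K\<rbrakk>
    \<Longrightarrow> K \<in> ribbon_joins_of S"

text \<open>Edge-ribbons \<open>e\<close> and \<open>f\<close> of a one-vertex ribbon graph are interlaced: removing the two ends
  of \<open>e\<close> from the boundary circle of the vertex-disc separates the two ends of \<open>f\<close>.  The flags
  \<open>x\<close> and \<open>tau_side G x\<close> lie on different ends of \<open>f\<close>.\<close>

definition interlaced :: "'a ribbon_graph \<Rightarrow> 'a set \<Rightarrow> 'a set \<Rightarrow> bool" where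
  "interlaced G e f \<longleftrightarrow>
     (\<forall>x\<in>f. (x, tau_side G x) \<notin> reach {tau_end G, tau_arc G} (flags G - e))"

definition is_B :: "nat \<Rightarrow> 'a ribbon_graph \<Rightarrow> bool" where
  "is_B n G \<longleftrightarrow> is_ribbon_graph G \<and> orientable_rg G \<and> num_vertices G = 1 \<and>
     card (edges G) = n \<and> pairwise (interlaced G) (edges G)"

end

theory Submission
  imports Defs
begin

text \<open>
  Write \<open>n(Z)\<close> for the number of boundary components of the spanning subgraph with the edges in
  \<open>Z\<close>. Euler's formula turns the genus of the partial dual at \<open>Z\<close> into a function of
  \<open>n(Z) + n(X - Z)\<close>, so that a single positive genus means that this sum is constant.

  Adding one edge changes \<open>n\<close> by one: two components merge, or one splits. Passing to a partial dual
  with one vertex, let \<open>n(\<emptyset>) = 1\<close>. Then each edge \<open>e\<close> splits the vertex circle, and \<open>e\<close>, \<open>f\<close> are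
  interlaced iff \<open>n({e, f}) = 1\<close> instead of \<open>3\<close>. If \<open>n(Z) + n(X - Z)\<close> is constant, then removing
  \<open>e\<close> merges two faces, and removing \<open>f\<close> as well splits the merged face again iff \<open>e\<close> and \<open>f\<close> have
  the same two faces. So being equal or interlaced is an equivalence relation. A class that is not
  everything leaves a gap of the vertex circle which can be cut off as a summand of a ribbon-join;
  if all \<open>m\<close> edges are interlaced, then \<open>n(A)\<close> is \<open>1\<close> or \<open>2\<close> according to the parity of \<open>|A|\<close>, and
  \<open>n(A) + n(X - A)\<close> is constant iff \<open>m\<close> is odd. Conversely \<open>n(A \<union> B) + 1 = n(A) + n(B)\<close> in a
  ribbon-join, so that the constancy is inherited.
\<close>

section \<open>Orbits of two involutions\<close>

text \<open>Orientability is what excludes the third possibility when an edge is added, namely that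
  the number of components stays the same. The sign \<open>c\<close> alternates along every
  involution, so a boundary walk that leaves a corner of a ribbon along an arc returns to the ribbon
  at a corner of the other sign; only a merge or a split remains. The same re-pairing of two links
  also describes the gluing of two arcs.

  For pairwise interlaced edges, \<open>n(A)\<close> is one plus the corank over GF(2) of the matrix
  J - I of size |A|, which is 0 for even and 1 for odd size. Linear algebra is avoided by
  two-colouring the boundary components: the edges whose sides differ in colour form a kernel vector
  of this matrix.

  The obstacle to cutting off a gap is that an edge outside the class might have its ends in
  different gaps. It would then have edges of the class on both sides, and these could not be
  interlaced with each other without one of them crossing it.

  The polynomial being non-constant serves to make the genus positive, which undoes the truncation
  by \<open>nat\<close>.\<close>

lemma fpf_even_card:
  assumes "finite D" "fpf_involution_on D t"
  shows "even (card D)"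
  using assms
proof (induction "card D" arbitrary: D rule: less_induct)
  case less
  show ?case
  proof (cases "D = {}")
    case False
    then obtain x where x: "x \<in> D" by blast
    let ?D = "D - {x, t x}"
    have tx: "t x \<in> D" "t x \<noteq> x" "t (t x) = x"
      using less.prems(2) x by (auto simp: fpf_involution_on_def)
    have "fpf_involution_on ?D t"
      using less.prems(2) tx unfolding fpf_involution_on_def by (metis Diff_iff insert_iff empty_iff)
    moreover have c: "card D = card ?D + 2"
    proof -
      have "card {x, t x} = 2" using tx by simp
      moreover have "card ?D = card D - card {x, t x}"
        using x tx by (intro card_Diff_subset) auto
      moreover have "card {x, t x} \<le> card D" using x tx less.prems(1) by (intro card_mono) auto
      ultimately show ?thesis by simp
    qed
    ultimately have "even (card ?D)" using less.hyps[of ?D] less.prems(1) by simp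
    then show ?thesis using c by simp
  qed simp
qed

lemma reach_step: "t \<in> T \<Longrightarrow> x \<in> X \<Longrightarrow> t x \<in> X \<Longrightarrow> (x, t x) \<in> reach T X"
  unfolding reach_def by blast

lemma reach_refl [simp]: "(x, x) \<in> reach T X"
  unfolding reach_def by simp

lemma reach_trans: "(x, y) \<in> reach T X \<Longrightarrow> (y, z) \<in> reach T X \<Longrightarrow> (x, z) \<in> reach T X"
  unfolding reach_def by (rule rtrancl_trans)

lemma reach_subset:
  assumes "\<And>t x. t \<in> T \<Longrightarrow> x \<in> X \<Longrightarrow> t x \<in> X \<Longrightarrow> (x, t x) \<in> r" "refl r" "trans r"
  shows "reach T X \<subseteq> r"
proof (rule subrelI)
  fix x y assume "(x, y) \<in> reach T X"
  then show "(x, y) \<in> r"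
    unfolding reach_def
  proof (induction rule: rtrancl_induct)
    case base
    then show ?case using assms(2) by (simp add: refl_onD)
  next
    case (step y z)
    then show ?case using assms(1,3) by (blast dest: transD)
  qed
qed

lemma reach_mono: "X \<subseteq> Y \<Longrightarrow> reach T X \<subseteq> reach T Y"
  unfolding reach_def by (rule rtrancl_mono) auto

lemma reach_closed:
  assumes "(x, y) \<in> reach T X" "x \<in> S"
    and "\<And>u t. u \<in> S \<Longrightarrow> u \<in> X \<Longrightarrow> t \<in> T \<Longrightarrow> t u \<in> X \<Longrightarrow> t u \<in> S"
  shows "y \<in> S"
proof -
  have "reach T X \<subseteq> {(u, v). u \<in> S \<longrightarrow> v \<in> S}"
    by (rule reach_subset) (auto simp: assms(3) refl_on_def trans_def)
  then show ?thesis using assms(1,2) by auto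
qed

lemma reach_restrict:
  assumes "(x, y) \<in> reach T X" "x \<in> S"
    and "\<And>u t. u \<in> S \<Longrightarrow> u \<in> X \<Longrightarrow> t \<in> T \<Longrightarrow> t u \<in> X \<Longrightarrow> t u \<in> S"
  shows "(x, y) \<in> reach T (X \<inter> S)"
proof -
  have "reach T X \<subseteq> {(u, v). u \<in> S \<longrightarrow> v \<in> S \<and> (u, v) \<in> reach T (X \<inter> S)}"
    by (rule reach_subset)
      (auto simp: assms(3) refl_on_def trans_def intro: reach_step intro: reach_trans)
  then show ?thesis using assms(1,2) by auto
qed

lemma reach_in: "(x, y) \<in> reach T X \<Longrightarrow> x \<in> X \<Longrightarrow> y \<in> X"
  by (rule reach_closed)

text \<open>Only the set of images of each point matters. Hence a construction that exchanges two of
  the involutions at some points, as partial duality does, leaves the relation unchanged.\<close>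

lemma reach_cong_image:
  assumes "\<And>x. x \<in> X \<Longrightarrow> (\<lambda>t. t x) ` T = (\<lambda>t. t x) ` T'"
  shows "reach T X = reach T' X"
proof -
  have steps: "{(x, t x) |x t. t \<in> T \<and> x \<in> X \<and> t x \<in> X} =
    {(x, y). x \<in> X \<and> y \<in> X \<and> y \<in> (\<lambda>t. t x) ` T}" for T :: "('a \<Rightarrow> 'a) set"
    by auto
  show ?thesis unfolding reach_def steps using assms by (metis (no_types, lifting))
qed

lemma reach_cong:
  assumes "\<And>x. x \<in> X \<Longrightarrow> s x = s' x" "\<And>x. x \<in> X \<Longrightarrow> t x = t' x"
  shows "reach {s, t} X = reach {s', t'} X"
  using assms by (intro reach_cong_image) simp

lemma sym_reach:
  assumes "\<And>t x. t \<in> T \<Longrightarrow> x \<in> X \<Longrightarrow> t x \<in> X \<Longrightarrow> t (t x) = x"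
  shows "sym (reach T X)"
proof -
  have "sym {(x, t x) |x t. t \<in> T \<and> x \<in> X \<and> t x \<in> X}"
    using assms by (auto simp: sym_def) metis
  then show ?thesis unfolding reach_def by (rule sym_rtrancl)
qed

text \<open>The carrier can be \<open>UNIV\<close> because the reflexive closure makes every point
  outside \<open>X\<close> a class of its own.\<close>

lemma equiv_reach:
  assumes "\<And>t. t \<in> T \<Longrightarrow> fpf_involution_on X t"
  shows "equiv UNIV (reach T X)"
proof (rule equivI)
  show "refl (reach T X)" by (simp add: refl_on_def)
  show "trans (reach T X)" by (rule transI) (rule reach_trans)
  show "sym (reach T X)" using assms by (intro sym_reach) (simp add: fpf_involution_on_def)
qed auto

section \<open>Uniting two classes of an equivalence relation\<close>

definition join_rel :: "('a \<times> 'a) set \<Rightarrow> 'a \<Rightarrow> 'a \<Rightarrow> ('a \<times> 'a) set" where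
  "join_rel r a d = r \<union> (r `` {a, d}) \<times> (r `` {a, d})"

lemma join_rel_iff:
  "(x, y) \<in> join_rel r a d \<longleftrightarrow>
    (x, y) \<in> r \<or> ((a, x) \<in> r \<or> (d, x) \<in> r) \<and> ((a, y) \<in> r \<or> (d, y) \<in> r)"
  by (auto simp: join_rel_def)

lemma equiv_join_rel:
  assumes "equiv UNIV r"
  shows "equiv UNIV (join_rel r a d)"
proof (rule equivI)
  have r: "refl r" "sym r" "trans r" using assms by (auto elim: equivE)
  show "refl (join_rel r a d)" using r by (auto simp: join_rel_def refl_on_def)
  show "sym (join_rel r a d)" using r by (auto simp: join_rel_def sym_def)
  show "trans (join_rel r a d)" using r unfolding join_rel_def trans_def sym_def by blast
qed auto

lemma card_quotient_join_rel:
  assumes r: "equiv UNIV r" and fin: "finite X"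
    and ad: "a \<in> X" "d \<in> X" "(a, d) \<notin> r"
  shows "card (X // r) = Suc (card (X // join_rel r a d))"
proof -
  let ?j = "join_rel r a d" and ?A = "r `` {a}" and ?D = "r `` {d}"
  have rr: "refl r" "sym r" "trans r" using r by (auto elim: equivE)
  have aA: "a \<in> ?A" and dD: "d \<in> ?D" using rr by (auto simp: refl_on_def)
  have cls: "?j `` {x} = (if x \<in> ?A \<union> ?D then ?A \<union> ?D else r `` {x})" for x
  proof -
    have "x \<in> ?A \<union> ?D \<Longrightarrow> (x, y) \<in> r \<Longrightarrow> y \<in> ?A \<union> ?D" for y
      using rr(3) by (auto dest: transD)
    then show ?thesis unfolding join_rel_def by auto
  qed
  have AD: "?A \<noteq> ?D" using ad(3) dD by auto
  have inq: "x \<in> X \<Longrightarrow> x \<notin> ?A \<union> ?D \<Longrightarrow> r `` {x} \<in> X // r - {?A, ?D}" for x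
    using rr by (auto simp: quotient_def refl_on_def)
  have q: "X // ?j = insert (?A \<union> ?D) (X // r - {?A, ?D})"
  proof (intro equalityI subsetI)
    fix S assume "S \<in> X // ?j"
    then obtain x where x: "x \<in> X" "S = ?j `` {x}" by (auto simp: quotient_def)
    then show "S \<in> insert (?A \<union> ?D) (X // r - {?A, ?D})"
      unfolding x(2) cls using inq[OF x(1)] by (cases "x \<in> ?A \<union> ?D") simp_all
  next
    fix S assume S: "S \<in> insert (?A \<union> ?D) (X // r - {?A, ?D})"
    show "S \<in> X // ?j"
    proof (cases "S = ?A \<union> ?D")
      case True
      then have "S = ?j `` {a}" using aA by (simp add: cls)
      then show ?thesis using ad(1) by (simp add: quotientI)
    next
      case False
      then obtain x where x: "x \<in> X" "S = r `` {x}" "S \<noteq> ?A" "S \<noteq> ?D"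
        using S by (auto simp: quotient_def)
      then have "x \<notin> ?A \<union> ?D" using r by (auto dest: equiv_class_eq)
      then have "S = ?j `` {x}" using x by (simp add: cls)
      then show ?thesis using x by (simp add: quotientI)
    qed
  qed
  have fq: "finite (X // r)" using fin by (simp add: quotient_def)
  have mem: "?A \<in> X // r" "?D \<in> X // r" using ad by (auto simp: quotient_def)
  have notin: "?A \<union> ?D \<notin> X // r - {?A, ?D}"
  proof
    assume "?A \<union> ?D \<in> X // r - {?A, ?D}"
    then obtain x where "?A \<union> ?D = r `` {x}" by (auto simp: quotient_def)
    then show False using aA dD ad(3) rr unfolding trans_def sym_def by blast
  qed
  have "card (X // ?j) = Suc (card (X // r - {?A, ?D}))"
    unfolding q using notin fq by simp
  also have "card (X // r - {?A, ?D}) = card (X // r) - 2"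
    using AD mem by (subst card_Diff_subset) auto
  finally have "card (X // ?j) = Suc (card (X // r) - 2)" .
  moreover have "card {?A, ?D} \<le> card (X // r)" using mem fq by (intro card_mono) auto
  ultimately show ?thesis using AD by simp
qed

text \<open>Orbits of two fixed-point free involutions are cycles, so that they stay connected when one
  link is cut. If the other end of the cut were not reached, then the involution \<open>t\<close> would pair all
  but one of the points of a set that is paired by \<open>s\<close>.\<close>

lemma reach_cut:
  assumes fin: "finite X" and s: "fpf_involution_on X s" and t: "fpf_involution_on X t"
    and a: "a \<in> X" and ay: "(a, y) \<in> reach {s, t} X" and y: "y \<notin> {a, s a}"
  shows "(t a, y) \<in> reach {s, t} (X - {a, s a})"
proof -
  let ?X = "X - {a, s a}"
  define D where "D = {y \<in> ?X. (t a, y) \<in> reach {s, t} ?X}"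
  have sX: "x \<in> X \<Longrightarrow> s x \<in> X \<and> s x \<noteq> x \<and> s (s x) = x" for x
    using s by (auto simp: fpf_involution_on_def)
  have tX: "x \<in> X \<Longrightarrow> t x \<in> X \<and> t x \<noteq> x \<and> t (t x) = x" for x
    using t by (auto simp: fpf_involution_on_def)
  have yX: "y \<in> X" using reach_in[OF ay a] .
  have taD: "t a \<in> D"
  proof (rule ccontr)
    assume "t a \<notin> D"
    then have "t a = s a" using tX[OF a] by (auto simp: D_def)
    have "y \<in> {a, s a}"
    proof (rule reach_closed[OF ay])
      fix u f assume "u \<in> {a, s a}" "f \<in> {s, t}"
      moreover have "t (s a) = a" using tX[OF a] \<open>t a = s a\<close> by simp
      ultimately show "f u \<in> {a, s a}" using sX[OF a] \<open>t a = s a\<close> by auto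
    qed simp
    then show False using y by simp
  qed
  have sD: "s x \<in> D" if "x \<in> D" for x
  proof -
    have x: "x \<in> ?X" "(t a, x) \<in> reach {s, t} ?X" using that by (auto simp: D_def)
    then have "s x \<in> ?X" using sX a by (metis Diff_iff insert_iff empty_iff)
    then show ?thesis using x reach_trans[OF x(2) reach_step[of s]] by (auto simp: D_def)
  qed
  have tD: "t x \<in> D" if "x \<in> D" "t x \<notin> {a, s a}" for x
  proof -
    have x: "x \<in> ?X" "(t a, x) \<in> reach {s, t} ?X" using that by (auto simp: D_def)
    then have "t x \<in> ?X" using tX that by blast
    then show ?thesis using x reach_trans[OF x(2) reach_step[of t]] by (auto simp: D_def)
  qed
  have DX: "D \<subseteq> X" by (auto simp: D_def)
  have finD: "finite D" using fin DX finite_subset by blast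
  have tsa: "t (s a) \<in> D"
  proof (rule ccontr)
    assume n: "t (s a) \<notin> D"
    have "fpf_involution_on D s" using sD sX DX by (auto simp: fpf_involution_on_def)
    then have "even (card D)" using finD by (rule fpf_even_card[rotated])
    \<comment> \<open>A step of \<open>t\<close> out of \<open>D\<close> must lead to
      \<open>a\<close> or \<open>s a\<close>, so it starts at \<open>t a\<close> or at
      \<open>t (s a)\<close>; the latter is assumed to lie outside \<open>D\<close>.\<close>
    moreover have "t x \<in> D - {t a}" if "x \<in> D - {t a}" for x
    proof -
      have "x \<in> X" "x \<noteq> a" using that DX by (auto simp: D_def)
      then show ?thesis using tD[of x] n that tX a sX by (metis Diff_iff insert_iff empty_iff)
    qed
    then have "fpf_involution_on (D - {t a}) t" using tX DX by (auto simp: fpf_involution_on_def)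
    then have "even (card (D - {t a}))" using finD by (intro fpf_even_card[of _ t]) auto
    moreover have "card D = Suc (card (D - {t a}))" using finD taD by (metis card.remove)
    ultimately show False by simp
  qed
  have "y \<in> D \<union> {a, s a}"
  proof (rule reach_closed[OF ay])
    fix u f assume u: "u \<in> D \<union> {a, s a}" "u \<in> X" and f: "f \<in> {s, t}"
    show "f u \<in> D \<union> {a, s a}"
      using u f sD[of u] tD[of u] taD tsa sX[OF a] by auto
  qed simp
  then show ?thesis using y by (simp add: D_def)
qed

text \<open>The walk \<open>a\<close>, \<open>t a\<close>, \<open>s (t a)\<close>, \<dots> up to its first return to \<open>Z\<close>.\<close>

lemma excursion:
  assumes fin: "finite X" and s: "fpf_involution_on X s" and t: "fpf_involution_on X t"
    and cs: "\<And>x. x \<in> X \<Longrightarrow> c (s x) \<noteq> c x" and ct: "\<And>x. x \<in> X \<Longrightarrow> c (t x) \<noteq> (c x :: bool)"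
    and Z: "Z \<subseteq> X" "\<And>x. x \<in> Z \<Longrightarrow> s x \<in> Z" and a: "a \<in> Z"
  obtains W b where "W \<subseteq> X" "W \<inter> Z = {a, b}" "c b \<noteq> c a"
    "\<And>x. x \<in> W \<Longrightarrow> t x \<in> W" "\<And>x. x \<in> W - Z \<Longrightarrow> s x \<in> W"
proof -
  have sX: "x \<in> X \<Longrightarrow> s x \<in> X \<and> s x \<noteq> x \<and> s (s x) = x" for x
    using s by (auto simp: fpf_involution_on_def)
  have tX: "x \<in> X \<Longrightarrow> t x \<in> X \<and> t x \<noteq> x \<and> t (t x) = x" for x
    using t by (auto simp: fpf_involution_on_def)
  \<comment> \<open>Extended by the identity, \<open>p\<close> is injective on the whole type, which
    makes the orbit of \<open>a\<close> periodic.\<close>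
  define p where "p x = (if x \<in> X then s (t x) else x)" for x
  have aX: "a \<in> X" using Z a by auto
  have pX: "p x \<in> X" if "x \<in> X" for x using that sX tX by (simp add: p_def)
  have pnX: "(p ^^ i) a \<in> X" for i by (induction i) (simp_all add: aX pX)
  have psuc: "(p ^^ Suc i) a = s (t ((p ^^ i) a))" for i
    using pnX[of i] by (simp add: p_def)
  have "inj p"
  proof (rule injI)
    fix x y assume "p x = p y"
    then show "x = y" using sX tX unfolding p_def by (metis (full_types))
  qed
  moreover have "finite {y. \<exists>n. y = (p ^^ n) a}"
    using fin by (rule finite_subset[rotated]) (use pnX in auto)
  ultimately obtain m where m: "m > 0" "(p ^^ m) a = a"
    using funpow_inj_finite[of p a] by auto
  then obtain k where k: "m = Suc k" by (cases m) auto
  \<comment> \<open>Just before closing up at \<open>a\<close>, the walk passes through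
    \<open>s a\<close>, which is in \<open>Z\<close>; so a first return exists.\<close>
  have "s (t ((p ^^ k) a)) = a" using m k psuc by simp
  then have "t ((p ^^ k) a) = s a" using sX tX pnX by metis
  then have ex: "\<exists>k. t ((p ^^ k) a) \<in> Z" using Z(2) a by metis
  define n where "n = (LEAST k. t ((p ^^ k) a) \<in> Z)"
  have n: "t ((p ^^ n) a) \<in> Z" unfolding n_def using ex by (rule LeastI_ex)
  have less: "t ((p ^^ i) a) \<notin> Z" if "i < n" for i
    using not_less_Least that unfolding n_def by blast
  have less': "(p ^^ Suc i) a \<notin> Z" if "i < n" for i
    using less[OF that] psuc Z(2) sX tX pnX by metis
  \<comment> \<open>Each application of \<open>p\<close> makes two colour changes. The walk ends
    after one more \<open>t\<close>, hence in the other colour.\<close>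
  have col: "c ((p ^^ i) a) = c a" for i
    by (induction i) (use cs ct sX tX pnX psuc in \<open>simp, metis\<close>)
  let ?b = "t ((p ^^ n) a)"
  let ?W = "(\<lambda>i. (p ^^ i) a) ` {..n} \<union> (\<lambda>i. t ((p ^^ i) a)) ` {..n}"
  show ?thesis
  proof
    show "?W \<subseteq> X" using pnX tX by auto
    have "x \<in> {a, ?b}" if x: "x \<in> ?W" "x \<in> Z" for x
    proof -
      from x(1) consider i where "i \<le> n" "x = (p ^^ i) a" | i where "i \<le> n" "x = t ((p ^^ i) a)"
        by auto
      then show ?thesis
      proof cases
        case 1 then show ?thesis using less' x(2)
          by (cases i) (auto simp del: funpow.simps(2))
      next
        case 2 then show ?thesis using less x(2) by (cases "i = n") auto
      qed
    qed
    moreover have "a \<in> ?W" by (auto intro!: image_eqI[of _ _ 0])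
    ultimately show "?W \<inter> Z = {a, ?b}" using n a by blast
    show "c ?b \<noteq> c a" using ct[OF pnX] col by metis
    show "t x \<in> ?W" if "x \<in> ?W" for x using that tX pnX by auto
    show "s x \<in> ?W" if xW: "x \<in> ?W - Z" for x
    proof -
      from xW consider i where "i \<le> n" "x = (p ^^ i) a" | i where "i \<le> n" "x = t ((p ^^ i) a)"
        by auto
      then show ?thesis
      proof cases
        case 1
        then obtain j where j: "i = Suc j" using xW a by (cases i) (use 1 in auto)
        then have "s x = t ((p ^^ j) a)" using 1 psuc sX tX pnX by metis
        then show ?thesis using 1 j by auto
      next
        case 2
        then have "i \<noteq> n" using xW n by auto
        then have "s x = (p ^^ Suc i) a" "Suc i \<le> n" using 2 psuc by auto
        then show ?thesis by blast
      qed
    qed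
  qed
qed

text \<open>\<open>s'\<close> arises from \<open>s\<close> by replacing the pairs \<open>{a, s a}\<close> and \<open>{s' a, s (s' a)}\<close> by \<open>{a, s' a}\<close>
  and \<open>{s a, s (s' a)}\<close>.\<close>

definition switch :: "'a set \<Rightarrow> ('a \<Rightarrow> 'a) \<Rightarrow> ('a \<Rightarrow> 'a) \<Rightarrow> 'a \<Rightarrow> bool" where
  "switch X s s' a \<longleftrightarrow> fpf_involution_on X s \<and> fpf_involution_on X s' \<and> a \<in> X \<and>
     s' (s a) = s (s' a) \<and> s a \<noteq> s' a \<and>
     (\<forall>x\<in>X - {a, s a, s' a, s (s' a)}. s' x = s x)"

lemma switch_sym: "switch X s s' a \<Longrightarrow> switch X s' s a"
  unfolding switch_def by (metis insert_commute)

text \<open>The two links to be replaced lie on different cycles. Each cycle remains connected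
  without its link, by \<open>reach_cut\<close>, and the two new links close the two resulting paths
  up to a single cycle.\<close>

lemma reach_switch_merge:
  assumes fin: "finite X" and t: "fpf_involution_on X t" and sw: "switch X s s' a"
    and no: "(a, s' a) \<notin> reach {s, t} X"
  shows "reach {s', t} X = join_rel (reach {s, t} X) a (s' a)"
proof -
  let ?r = "reach {s, t} X" and ?r' = "reach {s', t} X"
  let ?b = "s a" and ?d = "s' a" and ?c = "s (s' a)"
  have s: "fpf_involution_on X s" and s': "fpf_involution_on X s'" and a: "a \<in> X"
    and comm: "s' (s a) = s (s' a)" and ne: "s a \<noteq> s' a"
    and off: "\<And>x. x \<in> X \<Longrightarrow> x \<notin> {a, ?b, ?d, ?c} \<Longrightarrow> s' x = s x"
    using sw unfolding switch_def by blast+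
  have sX: "x \<in> X \<Longrightarrow> s x \<in> X \<and> s x \<noteq> x \<and> s (s x) = x" for x
    using s by (auto simp: fpf_involution_on_def)
  have s'X: "x \<in> X \<Longrightarrow> s' x \<in> X \<and> s' x \<noteq> x \<and> s' (s' x) = x" for x
    using s' by (auto simp: fpf_involution_on_def)
  have tX: "x \<in> X \<Longrightarrow> t x \<in> X \<and> t x \<noteq> x \<and> t (t x) = x" for x
    using t by (auto simp: fpf_involution_on_def)
  have eq: "equiv UNIV ?r" using s t by (intro equiv_reach) auto
  have eq': "equiv UNIV ?r'" using s' t by (intro equiv_reach) auto
  note rs = equivE[OF eq]
  have sr: "(x, s x) \<in> ?r" "(x, t x) \<in> ?r" if "x \<in> X" for x
    using that sX tX by (auto intro: reach_step)
  have s'r: "(x, s' x) \<in> ?r'" "(x, t x) \<in> ?r'" if "x \<in> X" for x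
    using that s'X tX by (auto intro: reach_step)
  have symr: "(x, y) \<in> ?r \<Longrightarrow> (y, x) \<in> ?r" for x y using eq by (meson equivE symD)
  have symr': "(x, y) \<in> ?r' \<Longrightarrow> (y, x) \<in> ?r'" for x y using eq' by (meson equivE symD)
  \<comment> \<open>The points \<open>u\<close> and \<open>s u\<close> stay connected by the way
    round the rest of their cycle. By the assumption on \<open>u\<close>, no other changed point
    lies there, so that \<open>s\<close> and \<open>s'\<close> agree along it.\<close>
  have uncut: "(u, s u) \<in> ?r'"
    if u: "u \<in> X" and away: "\<And>x. (u, x) \<in> ?r \<Longrightarrow> x \<in> {a, ?b, ?d, ?c} \<Longrightarrow> x \<in> {u, s u}" for u
  proof (cases "t u = s u")
    case True
    then show ?thesis using s'r(2)[OF u] by simp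
  next
    case False
    let ?X = "X - {u, s u}" and ?S = "{x. (u, x) \<in> ?r}"
    have "t (s u) \<noteq> u" "t (s u) \<noteq> s u" using False sX tX u by metis+
    moreover have "(u, t (s u)) \<in> ?r" using sr u sX reach_trans by metis
    ultimately have "(t u, t (s u)) \<in> reach {s, t} ?X"
      using reach_cut[OF fin s t u] by blast
    then have "(t u, t (s u)) \<in> reach {s, t} (?X \<inter> ?S)"
    proof (rule reach_restrict)
      show "t u \<in> ?S" using sr(2)[OF u] by simp
    next
      fix v f assume "v \<in> ?S" "v \<in> ?X" "f \<in> {s, t}"
      then show "f v \<in> ?S" using sr reach_trans by fastforce
    qed
    also have "reach {s, t} (?X \<inter> ?S) = reach {s', t} (?X \<inter> ?S)"
      using away off by (intro reach_cong) (auto, metis)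
    also have "\<dots> \<subseteq> ?r'" by (rule reach_mono) auto
    finally have "(t u, t (s u)) \<in> ?r'" .
    moreover have "(u, t u) \<in> ?r'" "(s u, t (s u)) \<in> ?r'" using s'r(2) u sX by auto
    ultimately show ?thesis using reach_trans symr' by metis
  qed
  have dX: "?d \<in> X" and bX: "?b \<in> X" and cX: "?c \<in> X" using a sX s'X by auto
  have ab: "(a, ?b) \<in> ?r'"
  proof (rule uncut[OF a])
    fix x assume "(a, x) \<in> ?r" "x \<in> {a, ?b, ?d, ?c}"
    then show "x \<in> {a, ?b}" using no sr(1)[OF dX] symr reach_trans by fast
  qed
  have dc: "(?d, ?c) \<in> ?r'"
  proof (rule uncut[OF dX])
    fix x assume "(?d, x) \<in> ?r" "x \<in> {a, ?b, ?d, ?c}"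
    then show "x \<in> {?d, ?c}" using no sr(1)[OF a] symr reach_trans by fast
  qed
  have sub: "?r \<subseteq> ?r'"
  proof (rule reach_subset)
    fix f x assume "f \<in> {s, t}" and x: "x \<in> X"
    then consider "f = t" | "f = s" "x \<notin> {a, ?b, ?d, ?c}" | "f = s" "x \<in> {a, ?b, ?d, ?c}" by auto
    then show "(x, f x) \<in> ?r'"
    proof cases
      case 3
      have "s ?b = a" "s ?c = ?d" using sX a dX by auto
      then show ?thesis using 3 ab dc symr' by auto
    qed (use s'r off x in metis)+
  qed (use eq' in \<open>auto elim: equivE\<close>)
  have ad: "(a, ?d) \<in> ?r'" using s'r a by auto
  have "join_rel ?r a ?d \<subseteq> ?r'"
  proof -
    have ax: "(a, x) \<in> ?r'" if "x \<in> ?r `` {a, ?d}" for x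
      using that sub reach_trans[OF ad, of x] by auto
    have "(x, y) \<in> ?r'" if "x \<in> ?r `` {a, ?d}" "y \<in> ?r `` {a, ?d}" for x y
      using reach_trans[OF symr'[OF ax] ax] that by blast
    then show ?thesis using sub unfolding join_rel_def by auto
  qed
  moreover have "?r' \<subseteq> join_rel ?r a ?d"
  proof (rule reach_subset)
    fix f x assume "f \<in> {s', t}" and x: "x \<in> X"
    then consider "f = t" | "f = s'" "x \<notin> {a, ?b, ?d, ?c}" | "f = s'" "x \<in> {a, ?b, ?d, ?c}" by auto
    then show "(x, f x) \<in> join_rel ?r a ?d"
    proof cases
      case 3
      have "s' ?c = ?b" "s' ?d = a" using s'X a bX comm by metis+
      then have "{x, s' x} \<subseteq> {a, ?b, ?d, ?c}" using 3 comm by auto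
      moreover have "{a, ?b, ?d, ?c} \<subseteq> ?r `` {a, ?d}" using sr a dX unfolding Image_def by auto
      ultimately have "(x, s' x) \<in> join_rel ?r a ?d" unfolding join_rel_def by blast
      then show ?thesis using 3(1) by simp
    next
      case 2
      then show ?thesis using sr(1)[OF x] off[OF x] by (simp add: join_rel_def)
    qed (use sr(2)[OF x] in \<open>simp add: join_rel_def\<close>)
  qed (use equiv_join_rel[OF eq] in \<open>auto elim: equivE\<close>)
  ultimately show ?thesis by blast
qed

text \<open>Starting at \<open>a\<close> with \<open>t\<close>, the first return to the four
  switched points has the colour opposite to \<open>a\<close>, hence happens at \<open>s a\<close>
  or at \<open>s' a\<close>. In the first case the walk is a full orbit of \<open>s\<close> and
  \<open>t\<close> without \<open>s' a\<close>, in the second a full orbit of \<open>s'\<close> and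
  \<open>t\<close> without \<open>s a\<close>. Without the colouring it could also return at
  \<open>s (s' a)\<close>.\<close>

lemma reach_switch_split:
  assumes fin: "finite X" and t: "fpf_involution_on X t" and sw: "switch X s s' a"
    and col: "\<And>x. x \<in> X \<Longrightarrow> c (s x) \<noteq> c x" "\<And>x. x \<in> X \<Longrightarrow> c (s' x) \<noteq> c x"
      "\<And>x. x \<in> X \<Longrightarrow> c (t x) \<noteq> (c x :: bool)"
    and yes: "(a, s' a) \<in> reach {s, t} X"
  shows "(a, s a) \<notin> reach {s', t} X"
proof
  assume yes': "(a, s a) \<in> reach {s', t} X"
  let ?Z = "{a, s a, s' a, s (s' a)}"
  have s: "fpf_involution_on X s" and s': "fpf_involution_on X s'" and a: "a \<in> X"
    and comm: "s' (s a) = s (s' a)" and ne: "s a \<noteq> s' a"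
    and off: "\<And>x. x \<in> X \<Longrightarrow> x \<notin> ?Z \<Longrightarrow> s' x = s x"
    using sw unfolding switch_def by blast+
  have sX: "x \<in> X \<Longrightarrow> s x \<in> X \<and> s x \<noteq> x \<and> s (s x) = x" for x
    using s by (auto simp: fpf_involution_on_def)
  have s'X: "x \<in> X \<Longrightarrow> s' x \<in> X \<and> s' x \<noteq> x \<and> s' (s' x) = x" for x
    using s' by (auto simp: fpf_involution_on_def)
  have Z: "?Z \<subseteq> X" "\<And>x. x \<in> ?Z \<Longrightarrow> s x \<in> ?Z" using a sX s'X by auto
  obtain W b where W: "W \<subseteq> X" "W \<inter> ?Z = {a, b}" "c b \<noteq> c a"
    "\<And>x. x \<in> W \<Longrightarrow> t x \<in> W" "\<And>x. x \<in> W - ?Z \<Longrightarrow> s x \<in> W"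
    using excursion[OF fin s t col(1,3) Z, of a] by auto
  have "c (s (s' a)) = c a" using col a s'X by metis
  moreover have "b \<in> ?Z" using W(2) by blast
  ultimately consider "b = s a" | "b = s' a" using W(3) by auto
  then show False
  proof cases
    case 1
    have "s' a \<in> W"
    proof (rule reach_closed[OF yes])
      fix u f assume u: "u \<in> W" "u \<in> X" and f: "f \<in> {s, t}"
      show "f u \<in> W"
      proof (cases "f = s \<and> u \<in> ?Z")
        case True
        then have "u \<in> {a, s a}" using W(2) u 1 by blast
        then show ?thesis using W(2) 1 sX[OF a] True by auto
      qed (use W(4,5) u f in auto)
    qed (use W(2) in auto)
    then have "s' a \<in> {a, s a}" using W(2) 1 by blast
    then show False using ne s'X[OF a] by auto
  next
    case 2
    have "s a \<in> W"
    proof (rule reach_closed[OF yes'])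
      fix u f assume u: "u \<in> W" "u \<in> X" and f: "f \<in> {s', t}"
      show "f u \<in> W"
      proof (cases "f = s' \<and> u \<in> ?Z")
        case True
        then have "u \<in> {a, s' a}" using W(2) u 2 by blast
        then show ?thesis using W(2) 2 s'X[OF a] True by auto
      qed (use W(4,5) u f off in auto)
    qed (use W(2) in auto)
    then have "s a \<in> {a, s' a}" using W(2) 2 by blast
    then show False using ne sX[OF a] by auto
  qed
qed

section \<open>Boundary components of spanning subgraphs\<close>

text \<open>A set of edges is represented by the set of its flags; partial duality then becomes a
  symmetric difference of sets of flags.\<close>

definition swap_sides :: "'a ribbon_graph \<Rightarrow> 'a set \<Rightarrow> 'a \<Rightarrow> 'a" where
  "swap_sides G Z x = (if x \<in> Z then tau_side G x else tau_end G x)"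

definition bd_rel :: "'a ribbon_graph \<Rightarrow> 'a set \<Rightarrow> ('a \<times> 'a) set" where
  "bd_rel G Z = reach {swap_sides G Z, tau_arc G} (flags G)"

text \<open>Isolated vertex-discs are left out; they contribute the same number for every
  \<open>Z\<close>.\<close>

definition bd_count :: "'a ribbon_graph \<Rightarrow> 'a set \<Rightarrow> nat" where
  "bd_count G Z = card (flags G // bd_rel G Z)"

definition edge_of :: "'a ribbon_graph \<Rightarrow> 'a \<Rightarrow> 'a set" where
  "edge_of G x = {x, tau_end G x, tau_side G x, tau_end G (tau_side G x)}"

definition edge_closed :: "'a ribbon_graph \<Rightarrow> 'a set \<Rightarrow> bool" where
  "edge_closed G Z \<longleftrightarrow> Z \<subseteq> flags G \<and> (\<forall>x\<in>Z. tau_end G x \<in> Z \<and> tau_side G x \<in> Z)"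

definition uniform_bd :: "'a ribbon_graph \<Rightarrow> bool" where
  "uniform_bd G \<longleftrightarrow> (\<exists>C. \<forall>Z. edge_closed G Z \<longrightarrow> bd_count G Z + bd_count G (flags G - Z) = C)"

definition iso_by :: "('a \<Rightarrow> 'b) \<Rightarrow> 'a ribbon_graph \<Rightarrow> 'b ribbon_graph \<Rightarrow> bool" where
  "iso_by f G H \<longleftrightarrow> bij_betw f (flags G) (flags H) \<and>
     (\<forall>x\<in>flags G. f (tau_end G x) = tau_end H (f x) \<and> f (tau_side G x) = tau_side H (f x) \<and>
       f (tau_arc G x) = tau_arc H (f x))"

lemma edge_closedI:
  "Z \<subseteq> flags G \<Longrightarrow> (\<And>x. x \<in> Z \<Longrightarrow> tau_end G x \<in> Z) \<Longrightarrow> (\<And>x. x \<in> Z \<Longrightarrow> tau_side G x \<in> Z)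
    \<Longrightarrow> edge_closed G Z"
  by (simp add: edge_closed_def)

section \<open>Component counts under isomorphism and partial duality\<close>

lemma card_quotient_bij:
  assumes f: "bij_betw f X Y" and T: "\<And>x. x \<in> X \<Longrightarrow> s x \<in> X \<and> t x \<in> X"
    and st: "\<And>x. x \<in> X \<Longrightarrow> f (s x) = s' (f x) \<and> f (t x) = t' (f x)"
  shows "card (X // reach {s, t} X) = card (Y // reach {s', t'} Y)"
proof -
  let ?r = "reach {s, t} X" and ?r' = "reach {s', t'} Y"
  have fY: "f x \<in> Y" if "x \<in> X" for x using f that by (auto simp: bij_betw_def)
  have img: "?r' `` {f x} = f ` (?r `` {x})" if x: "x \<in> X" for x
  proof (intro equalityI subsetI)
    fix z assume "z \<in> ?r' `` {f x}"
    then have "(f x, z) \<in> ?r'" by simp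
    then have "z \<in> f ` {y \<in> X. (x, y) \<in> ?r}"
    proof (rule reach_closed)
      show "f x \<in> f ` {y \<in> X. (x, y) \<in> ?r}" using x by simp
    next
      fix u g assume "u \<in> f ` {y \<in> X. (x, y) \<in> ?r}" and g: "g \<in> {s', t'}"
      then obtain y where y: "y \<in> X" "(x, y) \<in> ?r" "u = f y" by auto
      have "\<exists>h\<in>{s, t}. g u = f (h y)" using g st[OF y(1)] y(3) by auto
      then obtain h where h: "h \<in> {s, t}" "g u = f (h y)" by blast
      have "h y \<in> X" using T[OF y(1)] h by auto
      moreover have "(x, h y) \<in> ?r"
        using reach_trans[OF y(2) reach_step[OF h(1) y(1)]] \<open>h y \<in> X\<close> by simp
      ultimately show "g u \<in> f ` {y \<in> X. (x, y) \<in> ?r}" using h by simp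
    qed
    then show "z \<in> f ` (?r `` {x})" by auto
  next
    fix z assume "z \<in> f ` (?r `` {x})"
    then obtain y where y: "(x, y) \<in> ?r" "z = f y" by auto
    from y(1) have "y \<in> {y \<in> X. (f x, f y) \<in> ?r'}"
    proof (rule reach_closed)
      fix u g assume u: "u \<in> {y \<in> X. (f x, f y) \<in> ?r'}" and g: "g \<in> {s, t}"
      then have gu: "g u \<in> X" using T by auto
      have "\<exists>h\<in>{s', t'}. f (g u) = h (f u)" using g st u by auto
      then obtain h where h: "h \<in> {s', t'}" "f (g u) = h (f u)" by blast
      have "h (f u) \<in> Y" using h(2) gu fY by metis
      then have "(f u, h (f u)) \<in> ?r'" using h(1) u fY by (intro reach_step) auto
      then have "(f x, f (g u)) \<in> ?r'" using u h(2) reach_trans by auto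
      then show "g u \<in> {y \<in> X. (f x, f y) \<in> ?r'}" using gu by simp
    qed (use x in auto)
    then show "z \<in> ?r' `` {f x}" using y by auto
  qed
  have "Y // ?r' = (`) f ` (X // ?r)"
  proof -
    have "Y // ?r' = (\<lambda>y. ?r' `` {y}) ` Y" by (auto simp: quotient_def)
    also have "\<dots> = (\<lambda>y. ?r' `` {y}) ` f ` X" using f by (simp add: bij_betw_def)
    also have "\<dots> = (`) f ` (\<lambda>x. ?r `` {x}) ` X"
      using img by (simp add: image_image)
    also have "(\<lambda>x. ?r `` {x}) ` X = X // ?r" by (auto simp: quotient_def)
    finally show ?thesis .
  qed
  moreover have "inj_on ((`) f) (X // ?r)"
  proof (rule inj_onI)
    fix A B assume AB: "A \<in> X // ?r" "B \<in> X // ?r" "f ` A = f ` B"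
    have "?r `` {x} \<subseteq> X" if "x \<in> X" for x using that by (auto dest: reach_in)
    then have "A \<subseteq> X" "B \<subseteq> X" using AB(1,2) by (auto elim!: quotientE)
    then show "A = B" using AB(3) f by (auto simp: bij_betw_def inj_on_image_eq_iff)
  qed
  ultimately show ?thesis by (simp add: card_image)
qed

lemma bd_count_iso:
  assumes G: "is_ribbon_graph G" and f: "iso_by f G H" and Z: "Z \<subseteq> flags G"
  shows "bd_count H (f ` Z) = bd_count G Z"
proof -
  have bij: "bij_betw f (flags G) (flags H)" using f by (simp add: iso_by_def)
  have mem: "f x \<in> f ` Z \<longleftrightarrow> x \<in> Z" if "x \<in> flags G" for x
    using bij Z that by (auto simp: bij_betw_def dest: inj_onD)
  have "card (flags G // reach {swap_sides G Z, tau_arc G} (flags G)) =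
    card (flags H // reach {swap_sides H (f ` Z), tau_arc H} (flags H))"
  proof (rule card_quotient_bij[OF bij])
    fix x assume x: "x \<in> flags G"
    show "swap_sides G Z x \<in> flags G \<and> tau_arc G x \<in> flags G"
      using G x by (simp add: swap_sides_def is_ribbon_graph_def fpf_involution_on_def)
    show "f (swap_sides G Z x) = swap_sides H (f ` Z) (f x) \<and> f (tau_arc G x) = tau_arc H (f x)"
      using f x mem[OF x] by (simp add: iso_by_def swap_sides_def)
  qed
  then show ?thesis by (simp add: bd_count_def bd_rel_def)
qed

text \<open>Sides and ends are exchanged once by dualising at \<open>A\<close> and once by following
  \<open>Z\<close>; on the intersection the two exchanges cancel.\<close>

lemma swap_sides_partial_dual:
  "x \<in> flags G \<Longrightarrow> swap_sides (partial_dual G A) Z x = swap_sides G (sym_diff (\<Union>A) Z) x"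
  unfolding swap_sides_def partial_dual_def by auto

lemma bd_count_partial_dual:
  "bd_count (partial_dual G A) Z = bd_count G (sym_diff (\<Union>A) Z)"
proof -
  have "bd_rel (partial_dual G A) Z = bd_rel G (sym_diff (\<Union>A) Z)"
    unfolding bd_rel_def
    by (subst reach_cong[where s' = "swap_sides G (sym_diff (\<Union>A) Z)" and t' = "tau_arc G"])
      (auto simp: swap_sides_partial_dual[simplified] partial_dual_def swap_sides_def)
  then show ?thesis by (simp add: bd_count_def partial_dual_def)
qed

lemma num_vertices_partial_dual:
  "num_vertices (partial_dual G A) = bd_count G (\<Union>A) + isolated G"
proof -
  have "tau_end (partial_dual G A) = swap_sides G (\<Union>A)"
    by (rule ext) (simp add: partial_dual_def swap_sides_def)
  then show ?thesis
    by (simp add: num_vertices_def bd_count_def bd_rel_def orbits_def) (simp add: partial_dual_def)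
qed

lemma num_vertices_eq: "num_vertices G = bd_count G {} + isolated G"
proof -
  have "swap_sides G {} = tau_end G" by (rule ext) (simp add: swap_sides_def)
  then show ?thesis by (simp add: num_vertices_def bd_count_def bd_rel_def orbits_def)
qed

text \<open>The free sides of the dual are the attaching segments of the edges in \<open>A\<close>
  and the free sides of the others. This is what the boundary of the spanning subgraph on the
  complement of \<open>A\<close> follows.\<close>

lemma num_faces_partial_dual:
  "num_faces (partial_dual G A) = bd_count G (flags G - \<Union>A) + isolated G"
proof -
  have "reach {tau_side (partial_dual G A), tau_arc G} (flags G) = bd_rel G (flags G - \<Union>A)"
    unfolding bd_rel_def by (rule reach_cong) (auto simp: partial_dual_def swap_sides_def)
  then show ?thesis
    by (simp add: num_faces_def bd_count_def orbits_def) (simp add: partial_dual_def)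
qed

lemma edges_partial_dual: "edges (partial_dual G A) = edges G"
proof -
  have "reach {tau_end (partial_dual G A), tau_side (partial_dual G A)} (flags G) =
    reach {tau_end G, tau_side G} (flags G)"
    by (rule reach_cong_image) (simp add: partial_dual_def insert_commute)
  then show ?thesis by (simp add: edges_def orbits_def) (simp add: partial_dual_def)
qed

lemma num_components_partial_dual: "num_components (partial_dual G A) = num_components G"
proof -
  have "reach {tau_end (partial_dual G A), tau_side (partial_dual G A), tau_arc G} (flags G) =
    reach {tau_end G, tau_side G, tau_arc G} (flags G)"
    by (rule reach_cong_image) (simp add: partial_dual_def insert_commute)
  then show ?thesis by (simp add: num_components_def orbits_def) (simp add: partial_dual_def)
qed

section \<open>Oriented ribbon graphs: adding one edge\<close>

locale oriented_rg =
  fixes G :: "'a ribbon_graph" and c :: "'a \<Rightarrow> bool"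
  assumes rg: "is_ribbon_graph G"
    and col: "\<And>x. x \<in> flags G \<Longrightarrow>
      c (tau_end G x) \<noteq> c x \<and> c (tau_side G x) \<noteq> c x \<and> c (tau_arc G x) \<noteq> c x"
begin

abbreviation "X \<equiv> flags G"
abbreviation "\<epsilon> \<equiv> tau_end G"
abbreviation "\<sigma> \<equiv> tau_side G"
abbreviation "\<alpha> \<equiv> tau_arc G"
abbreviation "ed \<equiv> edge_of G"
abbreviation "R \<equiv> bd_rel G"
abbreviation "n \<equiv> bd_count G"
abbreviation "ec \<equiv> edge_closed G"

lemma fin: "finite X" using rg by (simp add: is_ribbon_graph_def)

lemma end_flag: "x \<in> X \<Longrightarrow> \<epsilon> x \<in> X" "x \<in> X \<Longrightarrow> \<epsilon> x \<noteq> x" "x \<in> X \<Longrightarrow> \<epsilon> (\<epsilon> x) = x"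
  using rg by (auto simp: is_ribbon_graph_def fpf_involution_on_def)

lemma side_flag: "x \<in> X \<Longrightarrow> \<sigma> x \<in> X" "x \<in> X \<Longrightarrow> \<sigma> x \<noteq> x" "x \<in> X \<Longrightarrow> \<sigma> (\<sigma> x) = x"
  using rg by (auto simp: is_ribbon_graph_def fpf_involution_on_def)

lemma arc_flag: "x \<in> X \<Longrightarrow> \<alpha> x \<in> X" "x \<in> X \<Longrightarrow> \<alpha> x \<noteq> x" "x \<in> X \<Longrightarrow> \<alpha> (\<alpha> x) = x"
  using rg by (auto simp: is_ribbon_graph_def fpf_involution_on_def)

lemma arc_fpf: "fpf_involution_on X \<alpha>"
  using rg by (simp add: is_ribbon_graph_def)

lemma side_end: "x \<in> X \<Longrightarrow> \<sigma> (\<epsilon> x) = \<epsilon> (\<sigma> x)"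
  using rg by (simp add: is_ribbon_graph_def)

lemma end_ne_side: "x \<in> X \<Longrightarrow> \<epsilon> x \<noteq> \<sigma> x"
  using rg by (simp add: is_ribbon_graph_def)

lemmas flag_simps = end_flag side_flag arc_flag side_end

lemma ed_self [simp]: "x \<in> ed x" by (simp add: edge_of_def)

lemma ec_ed: "x \<in> X \<Longrightarrow> ec (ed x)"
  by (rule edge_closedI) (auto simp: edge_of_def flag_simps)

lemma ed_subset: "ec Z \<Longrightarrow> x \<in> Z \<Longrightarrow> ed x \<subseteq> Z"
  by (auto simp: edge_of_def edge_closed_def)

lemma ec_subset: "ec Z \<Longrightarrow> Z \<subseteq> X"
  by (simp add: edge_closed_def)

lemma ed_eq: "x \<in> X \<Longrightarrow> y \<in> ed x \<Longrightarrow> ed y = ed x"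
  by (auto simp: edge_of_def flag_simps)

lemma ec_empty [simp]: "ec {}" by (simp add: edge_closed_def)

lemma ec_flags [simp]: "ec X" by (simp add: edge_closed_def flag_simps)

lemma ec_Un: "ec A \<Longrightarrow> ec B \<Longrightarrow> ec (A \<union> B)" by (auto simp: edge_closed_def)

lemma ec_Diff: assumes "ec A" "ec B" shows "ec (A - B)"
proof (rule edge_closedI)
  show "A - B \<subseteq> X" using assms by (auto simp: edge_closed_def)
  fix x assume x: "x \<in> A - B"
  then have xX: "x \<in> X" using assms(1) by (auto simp: edge_closed_def)
  have "\<epsilon> x \<notin> B" using x end_flag(3)[OF xX] assms(2) unfolding edge_closed_def by (metis DiffD2)
  then show "\<epsilon> x \<in> A - B" using x assms(1) by (auto simp: edge_closed_def)
  have "\<sigma> x \<notin> B" using x side_flag(3)[OF xX] assms(2) unfolding edge_closed_def by (metis DiffD2)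
  then show "\<sigma> x \<in> A - B" using x assms(1) by (auto simp: edge_closed_def)
qed

lemma ec_Union: "(\<And>Z. Z \<in> A \<Longrightarrow> ec Z) \<Longrightarrow> ec (\<Union>A)"
  unfolding edge_closed_def by blast

lemma ed_disjoint: "ec Z \<Longrightarrow> x \<in> X \<Longrightarrow> x \<notin> Z \<Longrightarrow> Z \<inter> ed x = {}"
  using ed_eq[of x] ed_subset[of Z] ed_self[of x] by blast

lemma edges_eq: "edges G = ed ` X"
proof -
  have "reach {\<epsilon>, \<sigma>} X `` {x} = ed x" if x: "x \<in> X" for x
  proof (intro equalityI subsetI)
    fix y assume "y \<in> reach {\<epsilon>, \<sigma>} X `` {x}"
    then have "(x, y) \<in> reach {\<epsilon>, \<sigma>} X" by simp
    then show "y \<in> ed x"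
      by (rule reach_closed) (use ec_ed[OF x] in \<open>auto simp: edge_closed_def\<close>)
  next
    have st: "z \<in> X \<Longrightarrow> (z, \<epsilon> z) \<in> reach {\<epsilon>, \<sigma>} X \<and> (z, \<sigma> z) \<in> reach {\<epsilon>, \<sigma>} X" for z
      by (simp add: reach_step flag_simps)
    fix y assume "y \<in> ed x"
    then consider "y = x" | "y = \<epsilon> x" | "y = \<sigma> x" | "y = \<epsilon> (\<sigma> x)" by (auto simp: edge_of_def)
    then show "y \<in> reach {\<epsilon>, \<sigma>} X `` {x}"
      using st[OF x] st[OF side_flag(1)[OF x]] reach_trans by cases fastforce+
  qed
  then show ?thesis unfolding edges_def orbits_def quotient_def by auto
qed

lemma edge_closed_eq_Union: assumes "ec Z" shows "Z = \<Union>{e \<in> edges G. e \<subseteq> Z}"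
proof -
  have "x \<in> \<Union>{e \<in> edges G. e \<subseteq> Z}" if x: "x \<in> Z" for x
  proof (rule UnionI)
    show "ed x \<in> {e \<in> edges G. e \<subseteq> Z}"
      using ed_subset[OF assms x] ec_subset[OF assms] x by (auto simp: edges_eq)
  qed simp
  then show ?thesis by auto
qed

lemma ec_Union_edges: "A \<subseteq> edges G \<Longrightarrow> ec (\<Union>A)"
  by (rule ec_Union) (auto simp: edges_eq ec_ed)

lemma swap_fpf: assumes "ec Z" shows "fpf_involution_on X (swap_sides G Z)"
proof -
  have "\<sigma> x \<in> Z \<longleftrightarrow> x \<in> Z" "\<epsilon> x \<in> Z \<longleftrightarrow> x \<in> Z" if "x \<in> X" for x
    using assms that end_flag(3) side_flag(3) unfolding edge_closed_def by metis+
  then show ?thesis by (auto simp: fpf_involution_on_def swap_sides_def flag_simps)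
qed

lemma swap_col: "x \<in> X \<Longrightarrow> c (swap_sides G Z x) \<noteq> c x"
  using col by (simp add: swap_sides_def)

lemma equiv_R: "ec Z \<Longrightarrow> equiv UNIV (R Z)"
  unfolding bd_rel_def using swap_fpf arc_fpf by (intro equiv_reach) auto

lemma R_sym: "ec Z \<Longrightarrow> (x, y) \<in> R Z \<Longrightarrow> (y, x) \<in> R Z"
  using equiv_R by (meson equivE symD)

lemma R_trans: "(x, y) \<in> R Z \<Longrightarrow> (y, z) \<in> R Z \<Longrightarrow> (x, z) \<in> R Z"
  unfolding bd_rel_def by (rule reach_trans)

lemma R_refl [simp]: "(x, x) \<in> R Z"
  unfolding bd_rel_def by simp

lemma R_arc: "x \<in> X \<Longrightarrow> (x, \<alpha> x) \<in> R Z"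
  unfolding bd_rel_def by (simp add: reach_step flag_simps)

lemma R_end: "x \<in> X \<Longrightarrow> x \<notin> Z \<Longrightarrow> (x, \<epsilon> x) \<in> R Z"
  using reach_step[of "swap_sides G Z" _ x X] unfolding bd_rel_def
  by (simp add: swap_sides_def flag_simps)

lemma R_side: "x \<in> Z \<Longrightarrow> x \<in> X \<Longrightarrow> (x, \<sigma> x) \<in> R Z"
  using reach_step[of "swap_sides G Z" _ x X] unfolding bd_rel_def
  by (simp add: swap_sides_def flag_simps)

lemma R_in: "(x, y) \<in> R Z \<Longrightarrow> x \<in> X \<Longrightarrow> y \<in> X"
  unfolding bd_rel_def by (rule reach_in)

lemma switch_edge:
  assumes "ec Z" "x \<in> X" "x \<notin> Z"
  shows "switch X (swap_sides G Z) (swap_sides G (Z \<union> ed x)) x"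
proof -
  have d: "Z \<inter> ed x = {}" using assms ed_disjoint by blast
  have e: "\<epsilon> x \<in> ed x" "\<sigma> x \<in> ed x" "\<epsilon> (\<sigma> x) \<in> ed x" by (auto simp: edge_of_def)
  have v: "swap_sides G Z x = \<epsilon> x" "swap_sides G (Z \<union> ed x) x = \<sigma> x"
    "swap_sides G (Z \<union> ed x) (\<epsilon> x) = \<epsilon> (\<sigma> x)" "swap_sides G Z (\<sigma> x) = \<epsilon> (\<sigma> x)"
    using d e assms(2,3) by (auto simp: swap_sides_def side_end)
  have "swap_sides G (Z \<union> ed x) y = swap_sides G Z y" if "y \<notin> {x, \<epsilon> x, \<sigma> x, \<epsilon> (\<sigma> x)}" for y
    using that by (simp add: swap_sides_def edge_of_def)
  then show ?thesis
    unfolding switch_def v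
    using assms(2) swap_fpf[OF assms(1)] swap_fpf[OF ec_Un[OF assms(1) ec_ed[OF assms(2)]]]
      end_ne_side[OF assms(2)] by blast
qed

text \<open>Adding an edge is a \<open>switch\<close> at its four corners. If \<open>x\<close> and
  \<open>\<sigma> x\<close> lie on different components, these merge. Otherwise the colouring forces
  a split, and the reversed switch is a merge. The relations are recorded along with the counts
  because later arguments ask which components are involved.\<close>

lemma toggle:
  assumes Z: "ec Z" and x: "x \<in> X" "x \<notin> Z"
  shows "(x, \<sigma> x) \<notin> R Z \<and> (x, \<epsilon> x) \<in> R (Z \<union> ed x) \<and> n Z = Suc (n (Z \<union> ed x)) \<and>
      R (Z \<union> ed x) = join_rel (R Z) x (\<sigma> x) \<or>
    (x, \<sigma> x) \<in> R Z \<and> (x, \<epsilon> x) \<notin> R (Z \<union> ed x) \<and> n (Z \<union> ed x) = Suc (n Z) \<and>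
      R Z = join_rel (R (Z \<union> ed x)) x (\<epsilon> x)"
proof -
  let ?Z = "Z \<union> ed x"
  have Z': "ec ?Z" using Z x ec_Un ec_ed by blast
  note sw = switch_edge[OF Z x]
  have v: "swap_sides G Z x = \<epsilon> x" "swap_sides G ?Z x = \<sigma> x"
    using x by (auto simp: swap_sides_def)
  show ?thesis
  proof (cases "(x, \<sigma> x) \<in> R Z")
    case False
    then have j: "R ?Z = join_rel (R Z) x (\<sigma> x)"
      using reach_switch_merge[OF fin arc_fpf sw] v by (simp add: bd_rel_def)
    then have "n Z = Suc (n ?Z)"
      using card_quotient_join_rel[OF equiv_R[OF Z] fin x(1) side_flag(1)[OF x(1)] False]
      by (simp add: bd_count_def)
    moreover have "(x, \<epsilon> x) \<in> R ?Z" using j R_end[OF x] by (auto simp: join_rel_def)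
    ultimately show ?thesis using False j by blast
  next
    case True
    have no: "(x, \<epsilon> x) \<notin> R ?Z"
      using reach_switch_split[OF fin arc_fpf sw, of c] v True swap_col col by (simp add: bd_rel_def)
    then have j: "R Z = join_rel (R ?Z) x (\<epsilon> x)"
      using reach_switch_merge[OF fin arc_fpf switch_sym[OF sw]] v by (simp add: bd_rel_def)
    then have "n ?Z = Suc (n Z)"
      using card_quotient_join_rel[OF equiv_R[OF Z'] fin x(1) end_flag(1)[OF x(1)] no]
      by (simp add: bd_count_def)
    then show ?thesis using True no j by blast
  qed
qed

lemma bd_count_pos: "X \<noteq> {} \<Longrightarrow> n Z > 0"
  using fin by (auto simp: bd_count_def card_gt_0_iff quotient_def)

lemma bd_count_eq_1_iff:
  assumes "ec Z" "X \<noteq> {}"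
  shows "n Z = 1 \<longleftrightarrow> (\<forall>x\<in>X. \<forall>y\<in>X. (x, y) \<in> R Z)"
proof
  assume "n Z = 1"
  then obtain S where S: "X // R Z = {S}" by (auto simp: bd_count_def card_1_singleton_iff)
  show "\<forall>x\<in>X. \<forall>y\<in>X. (x, y) \<in> R Z"
  proof (intro ballI)
    fix x y assume "x \<in> X" "y \<in> X"
    then have "R Z `` {x} = S" "R Z `` {y} = S" using S quotientI[of _ X "R Z"] by blast+
    then show "(x, y) \<in> R Z" using R_refl[of y Z] by blast
  qed
next
  assume a: "\<forall>x\<in>X. \<forall>y\<in>X. (x, y) \<in> R Z"
  then have "R Z `` {x} = X" if "x \<in> X" for x using that R_in by auto
  then have "X // R Z = {X}" using assms(2) by (auto simp: quotient_def)
  then show "n Z = 1" by (simp add: bd_count_def)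
qed

text \<open>Each \<open>toggle\<close> changes the count by exactly one. This fixes the parity of
  the number that is halved in \<open>genus\<close>.\<close>

lemma bd_count_parity:
  assumes "A \<subseteq> edges G"
  shows "even (n (\<Union>A) + n {} + card A)"
proof -
  have "finite A" using assms fin finite_subset by (fastforce simp: edges_eq)
  then show ?thesis using assms
  proof (induction A)
    case (insert e A)
    then obtain x where x: "x \<in> X" "e = ed x" by (auto simp: edges_eq)
    have ec: "ec (\<Union>A)" using insert.prems by (intro ec_Union_edges) auto
    have "x \<notin> \<Union>A"
    proof
      assume "x \<in> \<Union>A"
      then obtain y where y: "y \<in> X" "ed y \<in> A" "x \<in> ed y" using insert.prems by (auto simp: edges_eq)
      then show False using ed_eq[of y x] x insert.hyps by simp
    qed
    then have "n (\<Union>A \<union> ed x) = Suc (n (\<Union>A)) \<or> n (\<Union>A) = Suc (n (\<Union>A \<union> ed x))"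
      using toggle[OF ec x(1)] by blast
    moreover have "\<Union>(insert e A) = \<Union>A \<union> ed x" using x by auto
    moreover have "even (n (\<Union>A) + n {} + card A)" using insert by auto
    ultimately show ?case using insert.hyps by auto
  qed simp
qed

lemma ed_flags: "x \<in> X \<Longrightarrow> ed x \<subseteq> X"
  using ec_ed ec_subset by blast

lemma ed_sym: "x \<in> X \<Longrightarrow> y \<in> ed x \<Longrightarrow> x \<in> ed y"
  using ed_eq ed_self by blast

lemma end_in_ed [simp]: "\<epsilon> x \<in> ed x" and side_in_ed [simp]: "\<sigma> x \<in> ed x"
  by (auto simp: edge_of_def)

lemma ec_mem: "ec Z \<Longrightarrow> x \<in> X \<Longrightarrow> \<epsilon> x \<in> Z \<longleftrightarrow> x \<in> Z" "ec Z \<Longrightarrow> x \<in> X \<Longrightarrow> \<sigma> x \<in> Z \<longleftrightarrow> x \<in> Z"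
  using end_flag(3) side_flag(3) unfolding edge_closed_def by metis+

text \<open>The orbit of \<open>a\<close> is a cycle through the free side joining \<open>a\<close> and \<open>\<sigma> a\<close>, and meets the edge
  of \<open>a\<close> nowhere else.\<close>

lemma reach_off_edge:
  assumes a: "a \<in> X" and na: "(a, \<epsilon> a) \<notin> R (ed a)" and ay: "(a, y) \<in> R (ed a)" and y: "y \<notin> ed a"
  shows "(\<alpha> a, y) \<in> reach {\<epsilon>, \<alpha>} ((X - ed a) \<inter> R (ed a) `` {a})"
proof -
  let ?s = "swap_sides G (ed a)" and ?S = "R (ed a) `` {a}"
  have ec: "ec (ed a)" using ec_ed a by blast
  have sa: "?s a = \<sigma> a" by (simp add: swap_sides_def)
  have "(\<alpha> a, y) \<in> reach {?s, \<alpha>} (X - {a, ?s a})"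
  proof (rule reach_cut[OF fin swap_fpf[OF ec] arc_fpf a])
    show "(a, y) \<in> reach {?s, \<alpha>} X" using ay by (simp add: bd_rel_def)
    show "y \<notin> {a, ?s a}" using y sa by (auto simp: edge_of_def)
  qed
  then have p: "(\<alpha> a, y) \<in> reach {?s, \<alpha>} ((X - {a, \<sigma> a}) \<inter> ?S)"
    unfolding sa
  proof (rule reach_restrict)
    show "\<alpha> a \<in> ?S" using R_arc[OF a] by simp
  next
    fix u t assume u: "u \<in> ?S" "u \<in> X - {a, \<sigma> a}" "t \<in> {?s, \<alpha>}" "t u \<in> X - {a, \<sigma> a}"
    then have "(u, t u) \<in> R (ed a)" unfolding bd_rel_def by (intro reach_step) auto
    then show "t u \<in> ?S" using u(1) R_trans by blast
  qed
  have "\<epsilon> a \<notin> ?S" using na by simp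
  moreover have "\<epsilon> (\<sigma> a) \<notin> ?S"
  proof
    assume "\<epsilon> (\<sigma> a) \<in> ?S"
    moreover have "(\<epsilon> a, \<epsilon> (\<sigma> a)) \<in> R (ed a)"
      using R_side[of "\<epsilon> a" "ed a"] a by (simp add: flag_simps)
    ultimately show False using na R_sym[OF ec] R_trans by blast
  qed
  ultimately have "(X - {a, \<sigma> a}) \<inter> ?S = (X - ed a) \<inter> ?S" by (auto simp: edge_of_def)
  then have "(\<alpha> a, y) \<in> reach {?s, \<alpha>} ((X - ed a) \<inter> ?S)" using p by simp
  also have "reach {?s, \<alpha>} ((X - ed a) \<inter> ?S) = reach {\<epsilon>, \<alpha>} ((X - ed a) \<inter> ?S)"
    by (rule reach_cong) (auto simp: swap_sides_def)
  finally show ?thesis .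
qed

lemma Diff_Union_edges: "A \<subseteq> edges G \<Longrightarrow> X - \<Union>A = \<Union>(edges G - A)"
proof -
  assume A: "A \<subseteq> edges G"
  have U: "\<Union>(edges G) = X" using ed_flags by (auto simp: edges_eq)
  have "e = e'" if "e \<in> edges G" "e' \<in> edges G" "x \<in> e" "x \<in> e'" for e e' x
    using that ed_eq unfolding edges_eq by (metis imageE)
  then have "\<Union>A \<inter> \<Union>(edges G - A) = {}" using A by blast
  moreover have "\<Union>A \<union> \<Union>(edges G - A) = X" using U A by blast
  ultimately show ?thesis by blast
qed

lemma finite_edges: "finite (edges G)"
  using fin by (simp add: edges_eq)

end

section \<open>Linked edges of bouquets\<close>

locale bouquet = oriented_rg +
  assumes nonempty: "flags G \<noteq> {}" and one: "bd_count G {} = 1"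
begin

lemma R_empty: "x \<in> X \<Longrightarrow> y \<in> X \<Longrightarrow> (x, y) \<in> R {}"
  using bd_count_eq_1_iff[of "{}"] nonempty one by simp

text \<open>On one vertex circle the edge cannot merge anything, so it splits the circle; the two
  components are those of \<open>x\<close> and \<open>\<epsilon> x\<close>.\<close>

lemma single_edge:
  assumes x: "x \<in> X"
  shows "n (ed x) = 2" "(x, \<epsilon> x) \<notin> R (ed x)"
    "\<And>y. y \<in> X \<Longrightarrow> (x, y) \<in> R (ed x) \<or> (\<epsilon> x, y) \<in> R (ed x)"
proof -
  have *: "(x, \<epsilon> x) \<notin> R (ed x) \<and> n (ed x) = Suc (n {}) \<and> R {} = join_rel (R (ed x)) x (\<epsilon> x)"
    using toggle[of "{}", OF _ x] R_empty[OF x side_flag(1)[OF x]] by simp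
  then show "n (ed x) = 2" "(x, \<epsilon> x) \<notin> R (ed x)" using one by auto
  fix y assume "y \<in> X"
  then have "(x, y) \<in> join_rel (R (ed x)) x (\<epsilon> x)" using R_empty x * by auto
  then show "(x, y) \<in> R (ed x) \<or> (\<epsilon> x, y) \<in> R (ed x)" by (auto simp: join_rel_iff)
qed

text \<open>The two ends of the second edge, at \<open>y\<close> and \<open>\<sigma> y\<close>, lie
  either on different components left by the first edge, which then merge, or on the same one, which
  is then split.\<close>

lemma linked_cases:
  assumes x: "x \<in> X" and y: "y \<in> X" "y \<notin> ed x"
  shows "n (ed x \<union> ed y) = 1 \<and> (y, \<sigma> y) \<notin> R (ed x) \<or>
    n (ed x \<union> ed y) = 3 \<and> (y, \<sigma> y) \<in> R (ed x) \<and> R (ed x) = join_rel (R (ed x \<union> ed y)) y (\<epsilon> y)"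
  using toggle[OF ec_ed[OF x] y] single_edge(1)[OF x] by auto

text \<open>Interlacement concerns the vertex circle with the ends of an edge removed, whereas the
  count concerns the boundary that runs along this edge. Away from the edge both take the same
  steps, and \<open>reach_off_edge\<close> turns a boundary path into a path on the cut
  circle.\<close>

lemma interlaced_iff:
  assumes x: "x \<in> X" and y: "y \<in> X" "y \<notin> ed x"
  shows "interlaced G (ed x) (ed y) \<longleftrightarrow> n (ed x \<union> ed y) = 1"
proof
  assume one: "n (ed x \<union> ed y) = 1"
  show "interlaced G (ed x) (ed y)"
    unfolding interlaced_def
  proof
    fix z assume z: "z \<in> ed y"
    have zy: "ed z = ed y" "z \<in> X" using z y ed_eq ed_flags by blast+
    then have "z \<notin> ed x" using ed_eq[OF x] ed_self y by metis
    then have no: "(z, \<sigma> z) \<notin> R (ed x)" using linked_cases[OF x zy(2)] zy one by auto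
    have "reach {\<epsilon>, \<alpha>} (X - ed x) = reach {swap_sides G (ed x), \<alpha>} (X - ed x)"
      by (rule reach_cong) (auto simp: swap_sides_def)
    also have "\<dots> \<subseteq> R (ed x)" unfolding bd_rel_def by (rule reach_mono) auto
    finally show "(z, \<sigma> z) \<notin> reach {\<epsilon>, \<alpha>} (X - ed x)" using no by blast
  qed
next
  assume il: "interlaced G (ed x) (ed y)"
  show "n (ed x \<union> ed y) = 1"
  proof (rule ccontr)
    assume "n (ed x \<union> ed y) \<noteq> 1"
    then have ys: "(y, \<sigma> y) \<in> R (ed x)" using linked_cases[OF x y] by auto
    \<comment> \<open>The corner of the first edge is chosen on the component that contains both
      ends of the second.\<close>
    obtain a where a: "a \<in> ed x" "(a, y) \<in> R (ed x)"
      using single_edge(3)[OF x y(1)] end_in_ed ed_self by blast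
    have aX: "a \<in> X" and ea: "ed a = ed x" using ed_eq[OF x a(1)] ed_flags[OF x] a(1) by blast+
    have na: "(a, \<epsilon> a) \<notin> R (ed a)" using single_edge(2)[OF aX] .
    have ec: "ec (ed x)" using ec_ed x .
    have mono: "reach {\<epsilon>, \<alpha>} ((X - ed a) \<inter> R (ed a) `` {a}) \<subseteq> reach {\<epsilon>, \<alpha>} (X - ed x)"
      unfolding ea by (rule reach_mono) simp
    have 1: "(\<alpha> a, y) \<in> reach {\<epsilon>, \<alpha>} (X - ed x)"
      by (rule subsetD[OF mono reach_off_edge[OF aX na]]) (use a(2) y(2) ea in simp_all)
    have 2: "(\<alpha> a, \<sigma> y) \<in> reach {\<epsilon>, \<alpha>} (X - ed x)"
    proof (rule subsetD[OF mono reach_off_edge[OF aX na]])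
      show "(a, \<sigma> y) \<in> R (ed a)" using R_trans[OF a(2) ys] ea by simp
      show "\<sigma> y \<notin> ed a" using ec_mem[OF ec y(1)] y ea by simp
    qed
    have "sym (reach {\<epsilon>, \<alpha>} (X - ed x))"
      by (rule sym_reach) (auto simp: flag_simps)
    then have "(y, \<sigma> y) \<in> reach {\<epsilon>, \<alpha>} (X - ed x)"
      using 1 2 reach_trans by (meson symD)
    then show False using il unfolding interlaced_def by auto
  qed
qed

definition linked :: "'a \<Rightarrow> 'a \<Rightarrow> bool" where
  "linked x y \<longleftrightarrow> ed x = ed y \<or> n (ed x \<union> ed y) = 1"

lemma linked_iff: "x \<in> X \<Longrightarrow> y \<in> X \<Longrightarrow> y \<notin> ed x \<Longrightarrow> linked x y \<longleftrightarrow> (y, \<sigma> y) \<notin> R (ed x)"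
  using linked_cases[of x y] ed_self[of y] by (auto simp: linked_def)

lemma linked_sym: "linked x y \<Longrightarrow> linked y x"
  by (auto simp: linked_def Un_commute)

text \<open>A set \<open>Z\<close> of pairwise linked edges, none of them linked to \<open>x\<close>, lies on one side of \<open>x\<close>:
  otherwise the boundary components would split three times, whereas two linked edges undo each
  other's splitting.\<close>

lemma linked_set_one_side:
  assumes x: "x \<in> X" and Z: "Z \<subseteq> X" "\<And>z. z \<in> Z \<Longrightarrow> \<not> linked x z"
    "\<And>z z'. z \<in> Z \<Longrightarrow> z' \<in> Z \<Longrightarrow> linked z z'"
  shows "Z \<inter> R (ed x) `` {x} = {} \<or> Z \<inter> R (ed x) `` {\<epsilon> x} = {}"
proof (rule ccontr)
  assume "\<not> ?thesis"
  then obtain z z' where z: "z \<in> Z" "(x, z) \<in> R (ed x)" and z': "z' \<in> Z" "(\<epsilon> x, z') \<in> R (ed x)"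
    by auto
  have ec: "ec (ed x)" using ec_ed x .
  have zX: "z \<in> X" "z' \<in> X" using z z' Z by auto
  have off: "w \<notin> ed x" if "w \<in> Z" for w
    using Z(2)[OF that] ed_eq[OF x, of w] unfolding linked_def by metis
  have sz: "(w, \<sigma> w) \<in> R (ed x)" if "w \<in> Z" for w
    using linked_iff[OF x _ off[OF that]] Z that by auto
  have zz: "(z, z') \<notin> R (ed x)"
  proof
    assume "(z, z') \<in> R (ed x)"
    then have "(x, \<epsilon> x) \<in> R (ed x)" using z(2) z'(2) R_sym[OF ec] R_trans by blast
    then show False using single_edge(2)[OF x] by simp
  qed
  \<comment> \<open>An edge that is not linked to \<open>x\<close> has all its corners on one side
    of \<open>x\<close>.\<close>
  have ze: "z' \<notin> ed z"
  proof
    assume "z' \<in> ed z"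
    moreover have "w \<in> X \<Longrightarrow> w \<notin> ed x \<Longrightarrow> (w, \<epsilon> w) \<in> R (ed x)" for w using R_end by blast
    moreover have "\<sigma> z \<notin> ed x" using ec_mem[OF ec zX(1)] off[OF z(1)] by simp
    ultimately have "(z, z') \<in> R (ed x)"
      using sz[OF z(1)] off[OF z(1)] zX side_flag(1)[OF zX(1)] R_trans R_refl
      unfolding edge_of_def by blast
    then show False using zz by simp
  qed
  have j: "n (ed x \<union> ed z) = 3" "R (ed x) = join_rel (R (ed x \<union> ed z)) z (\<epsilon> z)"
    using linked_cases[OF x zX(1) off[OF z(1)]] Z(2)[OF z(1)] by (auto simp: linked_def)
  have ec2: "ec (ed x \<union> ed z)" using ec_Un ec ec_ed zX by blast
  \<comment> \<open>The split caused by \<open>z\<close> happens on the other side of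
    \<open>x\<close>, so it cannot separate the two ends of \<open>z'\<close>.\<close>
  have "(z', \<sigma> z') \<in> R (ed x \<union> ed z)"
  proof (rule ccontr)
    assume "(z', \<sigma> z') \<notin> R (ed x \<union> ed z)"
    then have "(z, z') \<in> R (ed x \<union> ed z) \<or> (\<epsilon> z, z') \<in> R (ed x \<union> ed z)"
      using sz[OF z'(1)] unfolding j(2) join_rel_iff by blast
    then have "(z, z') \<in> R (ed x)" unfolding j(2) join_rel_iff by simp
    then show False using zz by simp
  qed
  moreover have "z' \<notin> ed x \<union> ed z" using off z' ze by auto
  ultimately have four: "n (ed x \<union> ed z \<union> ed z') = 4" using toggle[OF ec2 zX(2)] j(1) by auto
  \<comment> \<open>The same three edges in another order: the two linked edges leave one component,
    and \<open>x\<close> can raise this to two at most.\<close>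
  have "n (ed z \<union> ed z') = 1" using Z(3)[OF z(1) z'(1)] ze ed_self[of z'] by (auto simp: linked_def)
  moreover have "x \<notin> ed z \<union> ed z'" using off z z' ed_sym zX by blast
  then have "n (ed z \<union> ed z' \<union> ed x) \<le> Suc (n (ed z \<union> ed z'))"
    using toggle[OF ec_Un[OF ec_ed ec_ed] x, of z z'] zX by auto
  moreover have "ed z \<union> ed z' \<union> ed x = ed x \<union> ed z \<union> ed z'" by auto
  ultimately show False using four by simp
qed

text \<open>One of the two parts into which the ends of \<open>x\<close> divide the vertex circle is
  free of \<open>Z\<close>; the walk follows that part.\<close>

lemma side_reach_off_linked_set:
  assumes x: "x \<in> X" and Z: "Z \<subseteq> X" "ec Z" "\<And>z. z \<in> Z \<Longrightarrow> \<not> linked x z"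
    "\<And>z z'. z \<in> Z \<Longrightarrow> z' \<in> Z \<Longrightarrow> linked z z'"
  shows "(x, \<sigma> x) \<in> reach {\<epsilon>, \<alpha>} (X - Z)"
proof -
  have main: "(w, \<sigma> w) \<in> reach {\<epsilon>, \<alpha>} (X - Z)" if w: "w \<in> X" and d: "Z \<inter> R (ed w) `` {w} = {}" for w
  proof -
    have ecw: "ec (ed w)" using ec_ed w .
    have sw: "\<sigma> w \<in> X" using w by (simp add: flag_simps)
    have ws: "(w, \<sigma> w) \<in> R (ed w)" using R_side[of w "ed w"] w by simp
    have was: "(w, \<alpha> (\<sigma> w)) \<in> R (ed w)" using ws R_arc[OF sw] R_trans by blast
    have inn: "{w, \<sigma> w, \<alpha> w, \<alpha> (\<sigma> w)} \<subseteq> X - Z"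
      using d ws was R_arc[OF w] R_refl[of w "ed w"] w by (auto simp: flag_simps)
    have 1: "(w, \<alpha> w) \<in> reach {\<epsilon>, \<alpha>} (X - Z)" using inn by (intro reach_step) auto
    show ?thesis
    proof (cases "\<alpha> w = \<sigma> w")
      \<comment> \<open>Here a single arc joins the two ends. In the other case
        \<open>\<alpha> (\<sigma> w)\<close> is the last flag before \<open>\<sigma> w\<close> and
        lies off the edge.\<close>
      case True
      then show ?thesis using 1 by simp
    next
      case False
      have na: "(w, \<epsilon> w) \<notin> R (ed w)" using single_edge(2)[OF w] .
      have "\<alpha> (\<sigma> w) \<notin> ed w"
      proof
        assume "\<alpha> (\<sigma> w) \<in> ed w"
        moreover have "\<alpha> (\<sigma> w) \<noteq> w" using False arc_flag(3)[OF sw] by metis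
        moreover have "\<alpha> (\<sigma> w) \<noteq> \<sigma> w" using arc_flag(2)[OF sw] .
        moreover have "(\<epsilon> w, \<epsilon> (\<sigma> w)) \<in> R (ed w)"
          using R_side[of "\<epsilon> w" "ed w"] w by (simp add: flag_simps)
        ultimately have "(w, \<epsilon> w) \<in> R (ed w) \<or>
            (w, \<epsilon> (\<sigma> w)) \<in> R (ed w) \<and> (\<epsilon> (\<sigma> w), \<epsilon> w) \<in> R (ed w)"
          using was R_sym[OF ecw] unfolding edge_of_def by force
        then show False using na R_trans by metis
      qed
      then have "(\<alpha> w, \<alpha> (\<sigma> w)) \<in> reach {\<epsilon>, \<alpha>} ((X - ed w) \<inter> R (ed w) `` {w})"
        by (rule reach_off_edge[OF w na was])
      moreover have "(X - ed w) \<inter> R (ed w) `` {w} \<subseteq> X - Z" using d by blast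
      ultimately have 2: "(\<alpha> w, \<alpha> (\<sigma> w)) \<in> reach {\<epsilon>, \<alpha>} (X - Z)"
        using reach_mono[THEN subsetD] by metis
      have "(\<alpha> (\<sigma> w), \<alpha> (\<alpha> (\<sigma> w))) \<in> reach {\<epsilon>, \<alpha>} (X - Z)"
        using inn arc_flag(3)[OF sw] by (intro reach_step) auto
      then show ?thesis using 1 2 arc_flag(3)[OF sw] reach_trans by metis
    qed
  qed
  have xZ: "x \<notin> Z" using Z(3) by (auto simp: linked_def)
  consider "Z \<inter> R (ed x) `` {x} = {}" | "Z \<inter> R (ed x) `` {\<epsilon> x} = {}"
    using linked_set_one_side[OF x Z(1,3,4)] by blast
  then show ?thesis
  proof cases
    case 1
    then show ?thesis using main x by blast
  next
    \<comment> \<open>The free part is the one seen from \<open>\<epsilon> x\<close>; crossing the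
      two ends of the edge brings the walk back to \<open>x\<close> and
      \<open>\<sigma> x\<close>.\<close>
    case 2
    have "ed (\<epsilon> x) = ed x" by (rule ed_eq[OF x]) simp
    then have "(\<epsilon> x, \<sigma> (\<epsilon> x)) \<in> reach {\<epsilon>, \<alpha>} (X - Z)" using main[of "\<epsilon> x"] 2 x by (simp add: flag_simps)
    moreover have end_step: "(w, \<epsilon> w) \<in> reach {\<epsilon>, \<alpha>} (X - Z)" if "w \<in> X" "w \<notin> Z" for w
      using that ec_mem(1)[OF Z(2)] by (intro reach_step[of \<epsilon>]) (simp_all add: end_flag(1))
    have "\<epsilon> (\<sigma> x) \<in> X" "\<epsilon> (\<sigma> x) \<notin> Z"
      using x xZ ec_mem[OF Z(2)] by (simp_all add: flag_simps)
    from end_step[OF this] have "(\<sigma> (\<epsilon> x), \<sigma> x) \<in> reach {\<epsilon>, \<alpha>} (X - Z)"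
      using x by (simp add: flag_simps)
    ultimately show ?thesis using end_step[OF x xZ] reach_trans by metis
  qed
qed

text \<open>With constant genus, each edge has two different faces, and two edges are linked exactly if
  they have the same two faces.\<close>

lemma linked_iff_same_faces:
  assumes u: "uniform_bd G" and x: "x \<in> X" and y: "y \<in> X"
  shows "linked x y \<longleftrightarrow> (x, y) \<in> R X \<and> (\<epsilon> x, \<epsilon> y) \<in> R X \<or> (x, \<epsilon> y) \<in> R X \<and> (\<epsilon> x, y) \<in> R X"
proof (cases "y \<in> ed x")
  case True
  have "(x, \<sigma> x) \<in> R X" "(\<epsilon> x, \<epsilon> (\<sigma> x)) \<in> R X"
    using R_side[of x X] R_side[of "\<epsilon> x" X] x by (simp_all add: flag_simps)
  then show ?thesis using True ed_eq[OF x True] x by (auto simp: linked_def edge_of_def flag_simps)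
next
  case False
  obtain C where C: "\<And>Z. ec Z \<Longrightarrow> n Z + n (X - Z) = C" using u by (auto simp: uniform_bd_def)
  have F: "1 + n X = C" using C[of "{}"] one by simp
  \<comment> \<open>The edge alone leaves two components instead of one, so that its removal from
    the full edge set must lower the other summand by one: it merges two faces.\<close>
  have single: "(z, \<epsilon> z) \<notin> R X \<and> n X = Suc (n (X - ed z)) \<and> R (X - ed z) = join_rel (R X) z (\<epsilon> z)"
    if z: "z \<in> X" for z
  proof -
    have "2 + n (X - ed z) = C" using C[OF ec_ed[OF z]] single_edge(1)[OF z] by simp
    moreover have "X - ed z \<union> ed z = X" using ed_flags[OF z] by auto
    ultimately show ?thesis
      using toggle[OF ec_Diff[OF ec_flags ec_ed[OF z]] z] F by auto
  qed
  note sx = single[OF x] and sy = single[OF y]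
  let ?Z = "X - (ed x \<union> ed y)"
  have ec2: "ec (ed x \<union> ed y)" using ec_Un ec_ed x y by blast
  have "?Z \<union> ed y = X - ed x" using ed_flags[OF y] ed_disjoint[OF ec_ed[OF x] y False] by auto
  then have "n ?Z = Suc (n (X - ed x)) \<and> (y, \<epsilon> y) \<in> R (X - ed x) \<or>
      n (X - ed x) = Suc (n ?Z) \<and> (y, \<epsilon> y) \<notin> R (X - ed x)"
    using toggle[OF ec_Diff[OF ec_flags ec2] y] by auto
  \<comment> \<open>With the sum fixed at \<open>1 + n X\<close>, two edges with one component leave
    \<open>n X\<close> on the complement, and two edges with three components leave two less. So
    linkage shows in whether the second removal splits or merges.\<close>
  then have "n (ed x \<union> ed y) = 1 \<longleftrightarrow> (y, \<epsilon> y) \<in> R (X - ed x)"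
    using C[OF ec2] F sx[THEN conjunct2, THEN conjunct1] by linarith
  moreover have "ed x \<noteq> ed y" using False by auto
  ultimately have "linked x y \<longleftrightarrow> (y, \<epsilon> y) \<in> join_rel (R X) x (\<epsilon> x)"
    using sx unfolding linked_def by metis
  also have "\<dots> \<longleftrightarrow> ((x, y) \<in> R X \<or> (\<epsilon> x, y) \<in> R X) \<and> ((x, \<epsilon> y) \<in> R X \<or> (\<epsilon> x, \<epsilon> y) \<in> R X)"
    using sy by (simp add: join_rel_iff)
  also have "\<dots> \<longleftrightarrow> (x, y) \<in> R X \<and> (\<epsilon> x, \<epsilon> y) \<in> R X \<or> (x, \<epsilon> y) \<in> R X \<and> (\<epsilon> x, y) \<in> R X"
  proof -
    \<comment> \<open>The two faces at \<open>y\<close> differ, so no single face at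
      \<open>x\<close> can be both of them.\<close>
    have "\<not> ((z, y) \<in> R X \<and> (z, \<epsilon> y) \<in> R X)" for z
      using sy R_sym[OF ec_flags] R_trans by blast
    then show ?thesis by auto
  qed
  finally show ?thesis .
qed

text \<open>Having the same unordered pair of faces is transitive.\<close>

lemma linked_trans:
  assumes u: "uniform_bd G" and X: "x \<in> X" "y \<in> X" "z \<in> X" and xy: "linked x y" and yz: "linked y z"
  shows "linked x z"
proof -
  note [simp] = linked_iff_same_faces[OF u]
  show ?thesis using xy yz X R_trans[of _ _ X] by simp blast
qed

end

section \<open>Pairwise linked edges: components and parity\<close>

lemma even_card_sym_diff:
  assumes "finite P" "finite Q" "card P = card Q"
  shows "even (card (sym_diff P Q))"
proof -
  have "card (P - Q) + card (P \<inter> Q) = card P" "card (Q - P) + card (P \<inter> Q) = card Q"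
    using card_Diff_subset_Int[of P Q] card_Diff_subset_Int[of Q P] assms
      card_mono[of P "P \<inter> Q"] card_mono[of Q "P \<inter> Q"] by (auto simp: Int_commute)
  then have "card (P - Q) = card (Q - P)" using assms(3) by simp
  moreover have "card (sym_diff P Q) = card (P - Q) + card (Q - P)"
    using assms by (intro card_Un_disjoint) auto
  ultimately show ?thesis by simp
qed

context bouquet
begin

text \<open>Let \<open>\<phi>\<close> be a two-colouring of the boundary components of the spanning subgraph with edges
  \<open>A\<close>. Comparing the colours along the part of the vertex circle between the two ends of \<open>a \<in> A\<close>
  shows that \<open>a\<close> is linked to an even number of the edges of \<open>A\<close> whose sides differ in colour.\<close>

lemma even_bicoloured_edges:
  assumes all: "\<And>x y. x \<in> X \<Longrightarrow> y \<in> X \<Longrightarrow> linked x y" and ecZ: "ec Z" and a: "a \<in> Z"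
    and arc: "\<And>z. z \<in> X \<Longrightarrow> \<phi> (\<alpha> z) = \<phi> z" and side: "\<And>z. z \<in> Z \<Longrightarrow> \<phi> (\<sigma> z) = (\<phi> z :: bool)"
    and ends: "\<And>z. z \<in> X \<Longrightarrow> z \<notin> Z \<Longrightarrow> \<phi> (\<epsilon> z) = \<phi> z"
  shows "even (card (ed ` {z \<in> X. \<phi> z \<noteq> \<phi> (\<epsilon> z)} - {ed a}))"
proof -
  have aX: "a \<in> X" using a ec_subset[OF ecZ] by auto
  have eca: "ec (ed a)" using ec_ed aX .
  define S where "S = R (ed a) `` {a}"
  have SX: "S \<subseteq> X" using R_in aX by (auto simp: S_def)
  have finS: "finite S" using SX fin finite_subset by blast
  have aS: "a \<in> S" by (simp add: S_def)
  have saS: "\<sigma> a \<in> S" using R_side[of a "ed a"] aX by (simp add: S_def)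
  have na: "(a, \<epsilon> a) \<notin> R (ed a)" using single_edge(2)[OF aX] .
  have eaS: "\<epsilon> a \<notin> S" using na by (simp add: S_def)
  have esaS: "\<epsilon> (\<sigma> a) \<notin> S"
  proof
    assume "\<epsilon> (\<sigma> a) \<in> S"
    moreover have "(\<epsilon> a, \<epsilon> (\<sigma> a)) \<in> R (ed a)"
      using R_side[of "\<epsilon> a" "ed a"] aX by (simp add: flag_simps)
    ultimately show False using na R_sym[OF eca] R_trans unfolding S_def by blast
  qed
  have arcS: "\<alpha> z \<in> S" if "z \<in> S" for z
    using that R_arc[of z "ed a"] SX R_trans unfolding S_def by blast
  have endS: "\<epsilon> z \<in> S - ed a" if "z \<in> S - ed a" for z
  proof -
    have "(z, \<epsilon> z) \<in> R (ed a)" using that SX R_end by blast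
    then have "\<epsilon> z \<in> S" using that R_trans unfolding S_def by blast
    then show ?thesis using that ec_mem(1)[OF eca, of z] SX by blast
  qed
  have Sed: "S \<inter> ed a = {a, \<sigma> a}" using aS saS eaS esaS by (auto simp: edge_of_def)
  have ca: "c (\<sigma> a) \<noteq> c a" using col aX by simp
  have pa: "\<phi> (\<sigma> a) = \<phi> a" using side a by simp

  \<comment> \<open>On this side of \<open>a\<close>, arcs pair the coloured flags of the two signs.
    Removing \<open>a\<close> and \<open>\<sigma> a\<close>, which have opposite signs and equal
    colour, preserves the balance. The remaining attaching segments then carry it over to a
    comparison of \<open>\<phi> z\<close> with \<open>\<phi> (\<epsilon> z)\<close> at the positive
    flags.\<close>
  define Q where "Q b = {z \<in> S. c z = b \<and> \<phi> z}" for b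
  define Q' where "Q' b = {z \<in> S - ed a. c z = b \<and> \<phi> z}" for b
  have finQ: "finite (Q b)" "finite (Q' b)" for b using finS by (auto simp: Q_def Q'_def)
  have "bij_betw \<alpha> (Q True) (Q False)"
    by (rule bij_betw_byWitness[where f' = \<alpha>]) (use SX arcS col arc arc_flag in \<open>auto simp: Q_def\<close>)
  then have QQ: "card (Q True) = card (Q False)" by (rule bij_betw_same_card)
  have "card (Q b) = card (Q' b) + (if \<phi> a then 1 else 0)" for b
  proof -
    let ?w = "if c a = b then a else \<sigma> a"
    have "Q b = Q' b \<union> {z \<in> S \<inter> ed a. c z = b \<and> \<phi> z}" by (auto simp: Q_def Q'_def)
    also have "{z \<in> S \<inter> ed a. c z = b \<and> \<phi> z} = (if \<phi> a then {?w} else {})"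
      unfolding Sed using ca pa by auto
    finally have Q: "Q b = Q' b \<union> (if \<phi> a then {?w} else {})" .
    have "?w \<notin> Q' b" by (auto simp: Q'_def)
    then show ?thesis unfolding Q using finQ(2)[of b] by (cases "\<phi> a") simp_all
  qed
  then have "card (Q' True) = card (Q' False)" using QQ by simp
  also have "\<dots> = card {z \<in> S - ed a. c z \<and> \<phi> (\<epsilon> z)}"
  proof (rule bij_betw_same_card[of \<epsilon>])
    show "bij_betw \<epsilon> (Q' False) {z \<in> S - ed a. c z \<and> \<phi> (\<epsilon> z)}"
    proof (rule bij_betw_byWitness[where f' = \<epsilon>])
      show "\<forall>z\<in>Q' False. \<epsilon> (\<epsilon> z) = z" "\<forall>z\<in>{z \<in> S - ed a. c z \<and> \<phi> (\<epsilon> z)}. \<epsilon> (\<epsilon> z) = z"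
        using SX end_flag(3) by (auto simp: Q'_def)
      show "\<epsilon> ` Q' False \<subseteq> {z \<in> S - ed a. c z \<and> \<phi> (\<epsilon> z)}"
      proof (rule image_subsetI)
        fix z assume z: "z \<in> Q' False"
        then have "z \<in> S - ed a" "z \<in> X" using SX by (auto simp: Q'_def)
        then show "\<epsilon> z \<in> {z \<in> S - ed a. c z \<and> \<phi> (\<epsilon> z)}"
          using endS[of z] col[of z] end_flag(3)[of z] z by (simp add: Q'_def)
      qed
      show "\<epsilon> ` {z \<in> S - ed a. c z \<and> \<phi> (\<epsilon> z)} \<subseteq> Q' False"
      proof (rule image_subsetI)
        fix z assume z: "z \<in> {z \<in> S - ed a. c z \<and> \<phi> (\<epsilon> z)}"
        then have "z \<in> S - ed a" "z \<in> X" using SX by auto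
        then show "\<epsilon> z \<in> Q' False" using endS[of z] col[of z] z by (simp add: Q'_def)
      qed
    qed
  qed
  finally have "even (card (sym_diff (Q' True) {z \<in> S - ed a. c z \<and> \<phi> (\<epsilon> z)}))"
    using finS finQ by (intro even_card_sym_diff) auto
  also have "sym_diff (Q' True) {z \<in> S - ed a. c z \<and> \<phi> (\<epsilon> z)} =
      {z \<in> S - ed a. c z \<and> \<phi> z \<noteq> \<phi> (\<epsilon> z)}" (is "_ = ?D")
    by (auto simp: Q'_def)
  finally have evenD: "even (card ?D)" .

  let ?d = "\<lambda>z. \<phi> z \<noteq> \<phi> (\<epsilon> z)"
  have d_end: "?d (\<epsilon> z) \<longleftrightarrow> ?d z" if "z \<in> X" for z using end_flag(3)[OF that] by auto
  have d_side: "?d (\<sigma> z) \<longleftrightarrow> ?d z" if z: "z \<in> X" for z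
  proof (cases "z \<in> Z")
    case True
    then have "\<phi> (\<sigma> z) = \<phi> z" "\<phi> (\<sigma> (\<epsilon> z)) = \<phi> (\<epsilon> z)" using side ec_mem(1)[OF ecZ z] by auto
    then show ?thesis using side_end[OF z] by simp
  next
    case False
    then show ?thesis using ends z ec_mem(2)[OF ecZ z] side_flag(1)[OF z] by auto
  qed
  have lk: "(z, \<sigma> z) \<notin> R (ed a)" if "z \<in> X" "z \<notin> ed a" for z
    using linked_iff[OF aX that] all aX that by auto
  \<comment> \<open>Any bicoloured edge other than that of \<open>a\<close> is linked to it, hence
    has exactly one end in \<open>S\<close>, and exactly one of the two flags there is
    positive.\<close>
  have "bij_betw ed ?D (ed ` {z \<in> X. ?d z} - {ed a})"
    unfolding bij_betw_def
  proof
    show "inj_on ed ?D"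
    proof (rule inj_onI)
      fix z w assume z: "z \<in> ?D" and w: "w \<in> ?D" and e: "ed z = ed w"
      have zX: "z \<in> X" using z SX by auto
      have "w \<in> ed z" using e by simp
      then consider "w = z" | "w = \<epsilon> z" | "w = \<sigma> z" | "w = \<epsilon> (\<sigma> z)" by (auto simp: edge_of_def)
      then show "z = w"
      proof cases
        case 2
        then show ?thesis using z w col[OF zX] by auto
      next
        case 3
        then show ?thesis using z w col[OF zX] by auto
      next
        case 4
        have "\<epsilon> w \<in> S" using endS[of w] w by auto
        then have "\<sigma> z \<in> S" using 4 side_flag(1)[OF zX] by (simp add: flag_simps)
        then have "(z, \<sigma> z) \<in> R (ed a)" using z R_sym[OF eca] R_trans unfolding S_def by blast
        then show ?thesis using lk[OF zX] z by auto
      qed simp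
    qed
    show "ed ` ?D = ed ` {z \<in> X. ?d z} - {ed a}"
    proof (intro equalityI subsetI)
      fix e assume "e \<in> ed ` ?D"
      then obtain z where z: "z \<in> ?D" "e = ed z" by auto
      then have "ed z \<noteq> ed a" using ed_self[of z] by (metis (no_types, lifting) DiffD2 mem_Collect_eq)
      then show "e \<in> ed ` {z \<in> X. ?d z} - {ed a}" using z SX by auto
    next
      fix e assume "e \<in> ed ` {z \<in> X. ?d z} - {ed a}"
      then obtain z where z: "z \<in> X" "?d z" "e = ed z" "ed z \<noteq> ed a" by auto
      have zn: "z \<notin> ed a" using ed_eq[OF aX] z(4) by blast
      have szn: "\<sigma> z \<notin> ed a" using ec_mem(2)[OF eca z(1)] zn by simp
      have sX: "\<sigma> z \<in> X" using side_flag(1)[OF z(1)] .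
      have "z \<in> S \<or> \<sigma> z \<in> S"
      proof (rule ccontr)
        assume "\<not> ?thesis"
        then have "(\<epsilon> a, z) \<in> R (ed a)" "(\<epsilon> a, \<sigma> z) \<in> R (ed a)"
          using single_edge(3)[OF aX] z(1) sX unfolding S_def by blast+
        then show False using lk[OF z(1) zn] R_sym[OF eca] R_trans by blast
      qed
      then obtain w where w: "w \<in> S - ed a" "ed w = e" "?d w" "w \<in> X"
      proof
        assume "z \<in> S"
        then show ?thesis using that[of z] z zn by auto
      next
        assume "\<sigma> z \<in> S"
        moreover have "ed (\<sigma> z) = ed z" by (rule ed_eq[OF z(1)]) simp
        ultimately show ?thesis using that[of "\<sigma> z"] z szn sX d_side[OF z(1)] by simp
      qed
      show "e \<in> ed ` ?D"
      proof (cases "c w")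
        case True
        then show ?thesis using w by auto
      next
        case False
        have "ed (\<epsilon> w) = ed w" by (rule ed_eq[OF w(4)]) simp
        then have "e = ed (\<epsilon> w)" using w(2) by simp
        moreover have "\<epsilon> w \<in> ?D" using False endS[OF w(1)] d_end[OF w(4)] w(3) col[OF w(4)] by auto
        ultimately show ?thesis by (rule image_eqI)
      qed
    qed
  qed
  from evenD[unfolded bij_betw_same_card[OF this]] show ?thesis .
qed

text \<open>If there were several components, colouring one of them gives a set \<open>T\<close> of
  bicoloured edges, non-empty because the vertex circle is connected. For each \<open>e\<close> in
  \<open>A\<close> the set \<open>T - {e}\<close> is even. An \<open>e\<close> in \<open>T\<close>
  makes \<open>T\<close> odd, and then no edge of \<open>A\<close> can lie outside \<open>T\<close>;
  so \<open>A = T\<close> would be odd.\<close>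

lemma all_linked_bd_count_even:
  assumes all: "\<And>x y. x \<in> X \<Longrightarrow> y \<in> X \<Longrightarrow> linked x y" and A: "A \<subseteq> edges G" and ev: "even (card A)"
  shows "n (\<Union>A) = 1"
proof (rule ccontr)
  assume n1: "n (\<Union>A) \<noteq> 1"
  let ?Z = "\<Union>A"
  have ecZ: "ec ?Z" using ec_Union_edges[OF A] .
  have ZX: "?Z \<subseteq> X" using ec_subset[OF ecZ] .
  have finA: "finite A" using A fin finite_surj[of X _ ed] finite_subset unfolding edges_eq by blast
  obtain x y where xy: "x \<in> X" "y \<in> X" "(x, y) \<notin> R ?Z"
    using n1 bd_count_eq_1_iff[OF ecZ nonempty] by auto
  define \<phi> where "\<phi> z \<longleftrightarrow> (x, z) \<in> R ?Z" for z
  have inv: "\<phi> w = \<phi> z" if "(z, w) \<in> R ?Z" for z w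
    using that R_sym[OF ecZ] R_trans unfolding \<phi>_def by blast
  have arc: "\<phi> (\<alpha> z) = \<phi> z" if "z \<in> X" for z using inv R_arc that by blast
  have side: "\<phi> (\<sigma> z) = \<phi> z" if "z \<in> ?Z" for z using inv R_side that ZX by blast
  have ends: "\<phi> (\<epsilon> z) = \<phi> z" if "z \<in> X" "z \<notin> ?Z" for z using inv R_end that by blast
  define T where "T = ed ` {z \<in> X. \<phi> z \<noteq> \<phi> (\<epsilon> z)}"
  have TA: "T \<subseteq> A"
  proof
    fix e assume "e \<in> T"
    then obtain z where z: "z \<in> X" "\<phi> z \<noteq> \<phi> (\<epsilon> z)" "e = ed z" by (auto simp: T_def)
    then have "z \<in> ?Z" using ends by auto
    then obtain e' where e': "e' \<in> A" "z \<in> e'" by auto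
    then obtain w where "w \<in> X" "e' = ed w" using A by (auto simp: edges_eq)
    then have "e' = e" using e' ed_eq z by metis
    then show "e \<in> A" using e' by simp
  qed
  have ec_even: "even (card (T - {e}))" if e: "e \<in> A" for e
  proof -
    obtain a where a: "a \<in> X" "e = ed a" using e A by (auto simp: edges_eq)
    then have "a \<in> ?Z" using e by auto
    then show ?thesis
      using even_bicoloured_edges[OF all ecZ _ arc side ends, of a] a unfolding T_def by simp
  qed
  have finT: "finite T" using TA finA finite_subset by blast
  have "T \<noteq> {}"
  proof
    assume "T = {}"
    then have "\<phi> (\<epsilon> z) = \<phi> z" if "z \<in> X" for z using that by (auto simp: T_def)
    then have st: "\<phi> (swap_sides G {} z) = \<phi> z" if "z \<in> X" for z
      using that by (simp add: swap_sides_def)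
    have "(x, y) \<in> reach {swap_sides G {}, \<alpha>} X" using R_empty[OF xy(1,2)] by (simp add: bd_rel_def)
    then have "y \<in> {z. \<phi> z}"
    proof (rule reach_closed)
      fix u t assume "u \<in> {z. \<phi> z}" "u \<in> X" "t \<in> {swap_sides G {}, \<alpha>}"
      then show "t u \<in> {z. \<phi> z}" using st[of u] arc[of u] by auto
    qed (simp add: \<phi>_def)
    then show False using xy by (simp add: \<phi>_def)
  qed
  then obtain e where e: "e \<in> T" by blast
  then have odd: "odd (card T)"
    using ec_even[of e] TA finT by (metis card.remove even_Suc subsetD)
  have "A = T"
  proof (rule ccontr)
    assume "A \<noteq> T"
    then obtain f where "f \<in> A" "f \<notin> T" using TA by blast
    then show False using ec_even[of f] odd by simp
  qed
  then show False using odd ev by simp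
qed

text \<open>Without one of its edges the set is even and has one component. Restoring the edge
  changes the count by one, and the count cannot drop to zero.\<close>

lemma all_linked_bd_count_odd:
  assumes all: "\<And>x y. x \<in> X \<Longrightarrow> y \<in> X \<Longrightarrow> linked x y" and A: "A \<subseteq> edges G" and od: "odd (card A)"
  shows "n (\<Union>A) = 2"
proof -
  have "A \<noteq> {}" using od by auto
  then obtain e where e: "e \<in> A" by blast
  then obtain x where x: "x \<in> X" "e = ed x" using A by (auto simp: edges_eq)
  let ?B = "A - {e}"
  have fA: "finite A" using od card.infinite by fastforce
  have B: "?B \<subseteq> edges G" "even (card ?B)" using A od e fA by (auto simp: card_Diff_singleton)
  have nB: "n (\<Union>?B) = 1" by (rule all_linked_bd_count_even[OF all B])
  have "x \<notin> \<Union>?B"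
  proof
    assume "x \<in> \<Union>?B"
    then obtain e' where e': "e' \<in> A" "e' \<noteq> e" "x \<in> e'" by auto
    then obtain w where "w \<in> X" "e' = ed w" using A by (auto simp: edges_eq)
    then have "e' = e" using e' ed_eq x by metis
    then show False using e' by simp
  qed
  then have "n (\<Union>?B \<union> ed x) = 2"
    using toggle[OF ec_Union_edges[OF B(1)] x(1)] nB bd_count_pos[OF nonempty, of "\<Union>?B \<union> ed x"] by auto
  moreover have "\<Union>?B \<union> ed x = \<Union>A" using e x by auto
  ultimately show ?thesis by simp
qed

lemma all_linked_uniform_iff:
  assumes all: "\<And>x y. x \<in> X \<Longrightarrow> y \<in> X \<Longrightarrow> linked x y"
  shows "uniform_bd G \<longleftrightarrow> odd (card (edges G))"
proof
  assume od: "odd (card (edges G))"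
  \<comment> \<open>Of an edge set and its complement exactly one is even, which gives
    \<open>1 + 2\<close>.\<close>
  have "n Z + n (X - Z) = 3" if Z: "ec Z" for Z
  proof -
    obtain A where A: "A \<subseteq> edges G" "Z = \<Union>A"
      by (rule that[of "{e \<in> edges G. e \<subseteq> Z}"]) (blast, rule edge_closed_eq_Union[OF Z])
    have "card A + card (edges G - A) = card (edges G)"
      using A finite_edges by (metis card_Un_disjoint Diff_disjoint Un_Diff_cancel finite_Diff
          finite_subset sup.absorb2)
    then have "even (card A) \<longleftrightarrow> odd (card (edges G - A))" using od by (metis even_add)
    then show ?thesis
      using all_linked_bd_count_even[OF all A(1)] all_linked_bd_count_odd[OF all A(1)]
        all_linked_bd_count_even[OF all, of "edges G - A"]
        all_linked_bd_count_odd[OF all, of "edges G - A"] Diff_Union_edges[OF A(1)]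
      by (cases "even (card A)") (auto simp: A(2))
  qed
  then show "uniform_bd G" unfolding uniform_bd_def by blast
next
  assume "uniform_bd G"
  then obtain C where C: "\<And>Z. ec Z \<Longrightarrow> n Z + n (X - Z) = C" by (auto simp: uniform_bd_def)
  show "odd (card (edges G))"
  proof
    assume ev: "even (card (edges G))"
    obtain x where x: "x \<in> X" using nonempty by blast
    \<comment> \<open>For an even total the empty set gives the sum \<open>1 + 1\<close>, a single
      edge \<open>2 + 2\<close>.\<close>
    let ?A = "{ed x}"
    have A: "?A \<subseteq> edges G" using x by (auto simp: edges_eq)
    then have "card (edges G - ?A) + 1 = card (edges G)"
      using finite_edges by (metis card.remove insert_subset Suc_eq_plus1)
    then have "odd (card (edges G - ?A))" using ev by (metis even_plus_one_iff)
    then have "n (X - ed x) = 2"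
      using all_linked_bd_count_odd[OF all, of "edges G - ?A"] Diff_Union_edges[OF A] by simp
    moreover have "n X = 1"
      using all_linked_bd_count_even[OF all _ ev] Diff_Union_edges[of "{}"] by simp
    ultimately show False using C[of "{}"] C[OF ec_ed[OF x]] one single_edge(1)[OF x] by simp
  qed
qed

lemma all_linked_iff_interlaced:
  "(\<forall>x\<in>X. \<forall>y\<in>X. linked x y) \<longleftrightarrow> pairwise (interlaced G) (edges G)"
proof -
  have "pairwise (interlaced G) (edges G) \<longleftrightarrow>
      (\<forall>x\<in>X. \<forall>y\<in>X. ed x \<noteq> ed y \<longrightarrow> interlaced G (ed x) (ed y))"
    unfolding pairwise_def edges_eq by blast
  also have "\<dots> \<longleftrightarrow> (\<forall>x\<in>X. \<forall>y\<in>X. linked x y)"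
  proof -
    have "(ed x \<noteq> ed y \<longrightarrow> interlaced G (ed x) (ed y)) \<longleftrightarrow> linked x y" if "x \<in> X" "y \<in> X" for x y
      using interlaced_iff[OF that] ed_eq[OF that(1), of y] unfolding linked_def by metis
    then show ?thesis by blast
  qed
  finally show ?thesis by blast
qed

end

section \<open>Ribbon-joins\<close>

lemma glue_arcs_simps [simp]:
  "flags (glue_arcs G x H y) = flags G \<union> flags H"
  "isolated (glue_arcs G x H y) = isolated G + isolated H"
  "tau_end (glue_arcs G x H y) z = (if z \<in> flags G then tau_end G z else tau_end H z)"
  "tau_side (glue_arcs G x H y) z = (if z \<in> flags G then tau_side G z else tau_side H z)"
  by (simp_all add: glue_arcs_def disjoint_union_rg_def Let_def)

locale gluing =
  fixes G H :: "'a ribbon_graph" and x y :: 'a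
  assumes rgG: "is_ribbon_graph G" and rgH: "is_ribbon_graph H"
    and disj: "flags G \<inter> flags H = {}" and xG: "x \<in> flags G" and yH: "y \<in> flags H"
begin

definition K where "K = glue_arcs G x H y"
text \<open>The arcs of the disjoint union. Passing from these to \<open>tau_arc K\<close> is a
  \<open>switch\<close> at \<open>x\<close>, so that gluing is treated like the addition of an edge,
  with the arcs changing and the sides fixed.\<close>

definition arcs where "arcs z = (if z \<in> flags G then tau_arc G z else tau_arc H z)"

lemma G_flag: "z \<in> flags G \<Longrightarrow> tau_end G z \<in> flags G \<and> tau_end G z \<noteq> z \<and> tau_end G (tau_end G z) = z"
  "z \<in> flags G \<Longrightarrow> tau_side G z \<in> flags G \<and> tau_side G z \<noteq> z \<and> tau_side G (tau_side G z) = z"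
  "z \<in> flags G \<Longrightarrow> tau_arc G z \<in> flags G \<and> tau_arc G z \<noteq> z \<and> tau_arc G (tau_arc G z) = z"
  using rgG by (auto simp: is_ribbon_graph_def fpf_involution_on_def)

lemma H_flag: "z \<in> flags H \<Longrightarrow> tau_end H z \<in> flags H \<and> tau_end H z \<noteq> z \<and> tau_end H (tau_end H z) = z"
  "z \<in> flags H \<Longrightarrow> tau_side H z \<in> flags H \<and> tau_side H z \<noteq> z \<and> tau_side H (tau_side H z) = z"
  "z \<in> flags H \<Longrightarrow> tau_arc H z \<in> flags H \<and> tau_arc H z \<noteq> z \<and> tau_arc H (tau_arc H z) = z"
  using rgH by (auto simp: is_ribbon_graph_def fpf_involution_on_def)

lemma notin: "z \<in> flags H \<Longrightarrow> z \<notin> flags G"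
  using disj by auto

lemma K_arc:
  "tau_arc K x = y" "tau_arc K y = x" "tau_arc K (tau_arc G x) = tau_arc H y"
  "tau_arc K (tau_arc H y) = tau_arc G x"
  "z \<notin> {x, y, tau_arc G x, tau_arc H y} \<Longrightarrow> tau_arc K z = arcs z"
proof -
  have d: "x \<noteq> y" "x \<noteq> tau_arc G x" "x \<noteq> tau_arc H y" "y \<noteq> tau_arc G x" "y \<noteq> tau_arc H y"
    "tau_arc G x \<noteq> tau_arc H y"
    using G_flag(3)[OF xG] H_flag(3)[OF yH] notin xG yH by metis+
  have f: "tau_arc K = (\<lambda>z. arcs z)(x := y, y := x, tau_arc G x := tau_arc H y,
      tau_arc H y := tau_arc G x)"
    by (simp add: K_def glue_arcs_def disjoint_union_rg_def Let_def arcs_def[abs_def])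
  show "tau_arc K x = y" "tau_arc K y = x" "tau_arc K (tau_arc G x) = tau_arc H y"
    "tau_arc K (tau_arc H y) = tau_arc G x"
    "z \<notin> {x, y, tau_arc G x, tau_arc H y} \<Longrightarrow> tau_arc K z = arcs z"
    unfolding f using d by auto
qed

lemma arcs_fpf: "fpf_involution_on (flags G \<union> flags H) arcs"
  unfolding fpf_involution_on_def
proof
  fix z assume "z \<in> flags G \<union> flags H"
  then show "arcs z \<in> flags G \<union> flags H \<and> arcs z \<noteq> z \<and> arcs (arcs z) = z"
    using G_flag(3)[of z] H_flag(3)[of z] notin[of z] notin[of "tau_arc H z"]
    by (cases "z \<in> flags G") (simp_all add: arcs_def)
qed

lemma K_arc_fpf: "fpf_involution_on (flags G \<union> flags H) (tau_arc K)"
  unfolding fpf_involution_on_def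
proof
  fix z assume z: "z \<in> flags G \<union> flags H"
  let ?S = "{x, y, tau_arc G x, tau_arc H y}"
  have ax: "tau_arc G x \<in> flags G" and ay: "tau_arc H y \<in> flags H" using G_flag H_flag xG yH by auto
  show "tau_arc K z \<in> flags G \<union> flags H \<and> tau_arc K z \<noteq> z \<and> tau_arc K (tau_arc K z) = z"
  proof (cases "z \<in> ?S")
    case True
    then show ?thesis using K_arc(1-4) ax ay xG yH notin by auto
  next
    case False
    have "arcs z \<in> flags G \<union> flags H" "arcs z \<noteq> z" "arcs (arcs z) = z"
      using arcs_fpf z by (auto simp: fpf_involution_on_def)
    moreover have "arcs z \<notin> ?S"
    proof
      assume "arcs z \<in> ?S"
      moreover have "arcs w \<in> ?S" if "w \<in> ?S" for w
        using that xG yH ax ay notin G_flag(3)[OF xG] H_flag(3)[OF yH] by (auto simp: arcs_def)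
      ultimately have "arcs (arcs z) \<in> ?S" by blast
      then show False using False \<open>arcs (arcs z) = z\<close> by simp
    qed
    ultimately show ?thesis using K_arc(5)[OF False] K_arc(5)[of "arcs z"] by auto
  qed
qed

lemma is_ribbon_graph_K: "is_ribbon_graph K"
proof -
  have "finite (flags G)" "finite (flags H)"
    "\<And>z. z \<in> flags G \<Longrightarrow> tau_end G (tau_side G z) = tau_side G (tau_end G z)"
    "\<And>z. z \<in> flags H \<Longrightarrow> tau_end H (tau_side H z) = tau_side H (tau_end H z)"
    "\<And>z. z \<in> flags G \<Longrightarrow> tau_end G z \<noteq> tau_side G z"
    "\<And>z. z \<in> flags H \<Longrightarrow> tau_end H z \<noteq> tau_side H z"
    using rgG rgH by (simp_all add: is_ribbon_graph_def)
  then show ?thesis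
    using K_arc_fpf G_flag H_flag notin
    unfolding is_ribbon_graph_def by (auto simp: K_def fpf_involution_on_def)
qed

text \<open>The colouring of \<open>H\<close> is inverted if \<open>x\<close> and \<open>y\<close> have the same colour.\<close>

lemma orientable_K:
  assumes "orientable_rg G" "orientable_rg H"
  shows "orientable_rg K"
proof -
  obtain c :: "'a \<Rightarrow> bool" where c: "\<forall>z\<in>flags G.
      c (tau_end G z) \<noteq> c z \<and> c (tau_side G z) \<noteq> c z \<and> c (tau_arc G z) \<noteq> c z"
    using assms(1)[unfolded orientable_rg_def] ..
  obtain d :: "'a \<Rightarrow> bool" where d: "\<forall>z\<in>flags H.
      d (tau_end H z) \<noteq> d z \<and> d (tau_side H z) \<noteq> d z \<and> d (tau_arc H z) \<noteq> d z"
    using assms(2)[unfolded orientable_rg_def] ..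
  define b where "b z = (if z \<in> flags G then c z else (d z \<longleftrightarrow> (c x \<noteq> d y)))" for z
  have bG: "b z = c z" if "z \<in> flags G" for z using that by (simp add: b_def)
  have bH: "b z \<longleftrightarrow> (d z \<longleftrightarrow> (c x \<noteq> d y))" if "z \<in> flags H" for z
    using notin[OF that] by (simp add: b_def)
  have es: "b (tau_end K z) \<noteq> b z \<and> b (tau_side K z) \<noteq> b z" if z: "z \<in> flags K" for z
  proof (cases "z \<in> flags G")
    case True
    then show ?thesis using bspec[OF c True] G_flag[OF True] by (simp add: K_def bG)
  next
    case False
    then have "z \<in> flags H" using z by (simp add: K_def)
    then show ?thesis using bspec[OF d, of z] H_flag[of z] False by (simp add: K_def bH) blast
  qed
  have bxy: "b (tau_arc G x) \<noteq> b x" "b (tau_arc H y) \<noteq> b y" "b x \<noteq> b y"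
    using bspec[OF c xG] bspec[OF d yH] G_flag(3)[OF xG] H_flag(3)[OF yH] xG yH
    by (auto simp: bG bH)
  have ar: "b (tau_arc K z) \<noteq> b z" if z: "z \<in> flags K" for z
  proof (cases "z \<in> {x, y, tau_arc G x, tau_arc H y}")
    case True
    then consider "z = x" | "z = y" | "z = tau_arc G x" | "z = tau_arc H y" by blast
    then show ?thesis using bxy by cases (simp_all add: K_arc(1-4))
  next
    case off: False
    show ?thesis
    proof (cases "z \<in> flags G")
      case True
      then show ?thesis using bspec[OF c True] G_flag(3)[OF True]
        by (simp add: K_arc(5)[OF off] arcs_def bG)
    next
      case False
      then have "z \<in> flags H" using z by (simp add: K_def)
      then show ?thesis using bspec[OF d, of z] H_flag(3)[of z] False
        by (simp add: K_arc(5)[OF off] arcs_def bH) blast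
    qed
  qed
  show ?thesis unfolding orientable_rg_def using es ar by blast
qed

text \<open>Before gluing the components add up. The two re-paired arcs belong to components of
  different summands, so exactly one merge takes place.\<close>

lemma bd_count_K:
  assumes Z: "edge_closed G Z" "edge_closed H Z'"
  shows "Suc (bd_count K (Z \<union> Z')) = bd_count G Z + bd_count H Z'"
proof -
  let ?U = "flags G \<union> flags H"
  let ?t = "swap_sides K (Z \<union> Z')"
  have ZZ: "Z \<subseteq> flags G" "Z' \<subseteq> flags H" using Z by (auto simp: edge_closed_def)
  have tG: "?t z = swap_sides G Z z" if "z \<in> flags G" for z
    using that ZZ disj by (auto simp: swap_sides_def K_def)
  have tH: "?t z = swap_sides H Z' z" if "z \<in> flags H" for z
    using that ZZ disj by (auto simp: swap_sides_def K_def)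
  have fU: "finite ?U" using rgG rgH by (simp add: is_ribbon_graph_def)
  have sG: "swap_sides G Z z \<in> flags G \<and> swap_sides G Z z \<noteq> z \<and> swap_sides G Z (swap_sides G Z z) = z"
    if z: "z \<in> flags G" for z
  proof -
    have "tau_end G z \<in> Z \<longleftrightarrow> z \<in> Z" "tau_side G z \<in> Z \<longleftrightarrow> z \<in> Z"
      using Z(1) G_flag(1,2)[OF z] unfolding edge_closed_def by metis+
    then show ?thesis using G_flag(1,2)[OF z] by (simp add: swap_sides_def)
  qed
  have sH: "swap_sides H Z' z \<in> flags H \<and> swap_sides H Z' z \<noteq> z \<and> swap_sides H Z' (swap_sides H Z' z) = z"
    if z: "z \<in> flags H" for z
  proof -
    have "tau_end H z \<in> Z' \<longleftrightarrow> z \<in> Z'" "tau_side H z \<in> Z' \<longleftrightarrow> z \<in> Z'"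
      using Z(2) H_flag(1,2)[OF z] unfolding edge_closed_def by metis+
    then show ?thesis using H_flag(1,2)[OF z] by (simp add: swap_sides_def)
  qed
  have t: "fpf_involution_on ?U ?t"
    unfolding fpf_involution_on_def using sG sH tG tH by (metis Un_iff)
  have ax: "tau_arc G x \<in> flags G" and ay: "tau_arc H y \<in> flags H" using G_flag H_flag xG yH by auto
  have v: "arcs x = tau_arc G x" "arcs y = tau_arc H y"
    using xG notin[OF yH] by (auto simp: arcs_def)
  have sw: "switch ?U arcs (tau_arc K) x"
    unfolding switch_def v(1) K_arc(1,3) v(2)
    using arcs_fpf K_arc_fpf xG ax yH disj K_arc(5) by auto
  let ?r = "reach {arcs, ?t} ?U"
  \<comment> \<open>No step before gluing leaves a summand, so the classes of the union are those of
    its parts.\<close>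
  have clsG: "?r `` {z} = bd_rel G Z `` {z} \<and> bd_rel G Z `` {z} \<subseteq> flags G" if z: "z \<in> flags G" for z
  proof -
    have eq: "reach {arcs, ?t} (flags G) = bd_rel G Z"
      unfolding bd_rel_def insert_commute[of arcs]
      by (rule reach_cong) (simp_all add: tG arcs_def)
    have "(z, w) \<in> bd_rel G Z" if "(z, w) \<in> ?r" for w
    proof -
      from that z have "(z, w) \<in> reach {arcs, ?t} (?U \<inter> flags G)"
      proof (rule reach_restrict)
        fix u f assume "u \<in> flags G" "f \<in> {arcs, ?t}"
        then show "f u \<in> flags G" using tG sG G_flag(3) by (auto simp: arcs_def)
      qed
      moreover have "?U \<inter> flags G = flags G" by auto
      ultimately show ?thesis using eq by simp
    qed
    moreover have "bd_rel G Z \<subseteq> ?r" unfolding eq[symmetric] by (rule reach_mono) auto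
    moreover have "bd_rel G Z `` {z} \<subseteq> flags G"
      unfolding bd_rel_def using z by (auto dest: reach_in)
    ultimately show ?thesis by blast
  qed
  have clsH: "?r `` {z} = bd_rel H Z' `` {z} \<and> bd_rel H Z' `` {z} \<subseteq> flags H" if z: "z \<in> flags H" for z
  proof -
    have eq: "reach {arcs, ?t} (flags H) = bd_rel H Z'"
      unfolding bd_rel_def insert_commute[of arcs]
      by (rule reach_cong) (simp_all add: tH arcs_def notin)
    have "(z, w) \<in> bd_rel H Z'" if "(z, w) \<in> ?r" for w
    proof -
      from that z have "(z, w) \<in> reach {arcs, ?t} (?U \<inter> flags H)"
      proof (rule reach_restrict)
        fix u f assume "u \<in> flags H" "f \<in> {arcs, ?t}"
        then show "f u \<in> flags H" using tH sH H_flag(3) notin by (auto simp: arcs_def)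
      qed
      moreover have "?U \<inter> flags H = flags H" by auto
      ultimately show ?thesis using eq by simp
    qed
    moreover have "bd_rel H Z' \<subseteq> ?r" unfolding eq[symmetric] by (rule reach_mono) auto
    moreover have "bd_rel H Z' `` {z} \<subseteq> flags H"
      unfolding bd_rel_def using z by (auto dest: reach_in)
    ultimately show ?thesis by blast
  qed
  have "(x, y) \<notin> ?r" using clsG[OF xG] notin[OF yH] by blast
  then have no: "(x, tau_arc K x) \<notin> ?r" by (simp add: K_arc)
  have "reach {tau_arc K, ?t} ?U = join_rel ?r x (tau_arc K x)"
    by (rule reach_switch_merge[OF fU t sw no])
  moreover have "equiv UNIV ?r" using arcs_fpf t by (intro equiv_reach) auto
  ultimately have "card (?U // ?r) = Suc (card (?U // reach {tau_arc K, ?t} ?U))"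
    using card_quotient_join_rel[of ?r ?U x "tau_arc K x"] fU xG yH no by (simp add: K_arc)
  moreover have "bd_count K (Z \<union> Z') = card (?U // reach {tau_arc K, ?t} ?U)"
    unfolding bd_count_def bd_rel_def insert_commute[of "tau_arc K"] by (simp add: K_def)
  moreover have "card (?U // ?r) = bd_count G Z + bd_count H Z'"
  proof -
    have q: "A // ?r = (\<lambda>z. ?r `` {z}) ` A" for A by (auto simp: quotient_def)
    have qG: "flags G // ?r = flags G // bd_rel G Z" and qH: "flags H // ?r = flags H // bd_rel H Z'"
      using clsG clsH by (auto simp: quotient_def)
    have "?U // ?r = flags G // ?r \<union> flags H // ?r" unfolding q by (rule image_Un)
    moreover have "flags G // ?r \<inter> flags H // ?r = {}"
    proof (rule ccontr)
      assume "flags G // ?r \<inter> flags H // ?r \<noteq> {}"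
      then obtain g h where g: "g \<in> flags G" "h \<in> flags H" "?r `` {g} = ?r `` {h}"
        unfolding q by auto
      moreover have "g \<in> ?r `` {g}" by simp
      ultimately show False using clsH[OF g(2)] notin by blast
    qed
    moreover have "finite (flags G // ?r)" "finite (flags H // ?r)" using fU unfolding q by auto
    ultimately have "card (?U // ?r) = card (flags G // ?r) + card (flags H // ?r)"
      by (simp add: card_Un_disjoint)
    then show ?thesis unfolding qG qH bd_count_def .
  qed
  ultimately show ?thesis by simp
qed

lemma edge_closed_K:
  "edge_closed K Z \<longleftrightarrow> Z \<subseteq> flags K \<and> edge_closed G (Z \<inter> flags G) \<and> edge_closed H (Z \<inter> flags H)"
proof
  assume Z: "edge_closed K Z"
  have "edge_closed G (Z \<inter> flags G)"
  proof (rule edge_closedI)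
    fix z assume z: "z \<in> Z \<inter> flags G"
    then have "tau_end K z \<in> Z" "tau_side K z \<in> Z" using Z by (auto simp: edge_closed_def)
    then show "tau_end G z \<in> Z \<inter> flags G" "tau_side G z \<in> Z \<inter> flags G"
      using z G_flag by (auto simp: K_def)
  qed simp
  moreover have "edge_closed H (Z \<inter> flags H)"
  proof (rule edge_closedI)
    fix z assume z: "z \<in> Z \<inter> flags H"
    then have "tau_end K z \<in> Z" "tau_side K z \<in> Z" using Z by (auto simp: edge_closed_def)
    then show "tau_end H z \<in> Z \<inter> flags H" "tau_side H z \<in> Z \<inter> flags H"
      using z H_flag notin by (auto simp: K_def)
  qed simp
  ultimately show "Z \<subseteq> flags K \<and> edge_closed G (Z \<inter> flags G) \<and> edge_closed H (Z \<inter> flags H)"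
    using Z by (simp add: edge_closed_def)
next
  assume Z: "Z \<subseteq> flags K \<and> edge_closed G (Z \<inter> flags G) \<and> edge_closed H (Z \<inter> flags H)"
  show "edge_closed K Z"
  proof (rule edge_closedI)
    fix z assume "z \<in> Z"
    then show "tau_end K z \<in> Z" "tau_side K z \<in> Z"
      using Z notin by (auto simp: K_def edge_closed_def)
  qed (use Z in simp)
qed

text \<open>The \<open>2\<close> stands for one merge in the count for \<open>Z\<close> and one in
  the count for its complement.\<close>

lemma bd_count_sum_K:
  assumes "edge_closed K Z"
  shows "bd_count K Z + bd_count K (flags K - Z) + 2 =
    (bd_count G (Z \<inter> flags G) + bd_count G (flags G - Z \<inter> flags G)) +
    (bd_count H (Z \<inter> flags H) + bd_count H (flags H - Z \<inter> flags H))"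
proof -
  have Z: "Z \<subseteq> flags K" "edge_closed G (Z \<inter> flags G)" "edge_closed H (Z \<inter> flags H)"
    using assms by (auto simp: edge_closed_K)
  have dG: "edge_closed G (flags G - Z \<inter> flags G)"
  proof (rule edge_closedI)
    fix z assume z: "z \<in> flags G - Z \<inter> flags G"
    then have "tau_end G z \<notin> Z" "tau_side G z \<notin> Z"
      using Z(2) G_flag(1,2)[of z] unfolding edge_closed_def by (metis DiffE IntI)+
    then show "tau_end G z \<in> flags G - Z \<inter> flags G" "tau_side G z \<in> flags G - Z \<inter> flags G"
      using z G_flag by auto
  qed auto
  have dH: "edge_closed H (flags H - Z \<inter> flags H)"
  proof (rule edge_closedI)
    fix z assume z: "z \<in> flags H - Z \<inter> flags H"
    then have "tau_end H z \<notin> Z" "tau_side H z \<notin> Z"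
      using Z(3) H_flag(1,2)[of z] unfolding edge_closed_def by (metis DiffE IntI)+
    then show "tau_end H z \<in> flags H - Z \<inter> flags H" "tau_side H z \<in> flags H - Z \<inter> flags H"
      using z H_flag by auto
  qed auto
  have "Z \<inter> flags G \<union> Z \<inter> flags H = Z" "(flags G - Z \<inter> flags G) \<union> (flags H - Z \<inter> flags H) = flags K - Z"
    using Z(1) disj by (auto simp: K_def)
  then show ?thesis using bd_count_K[OF Z(2,3)] bd_count_K[OF dG dH] by simp
qed

lemma uniform_K:
  assumes "uniform_bd G" "uniform_bd H"
  shows "uniform_bd K"
proof -
  obtain C where C: "\<And>Z. edge_closed G Z \<Longrightarrow> bd_count G Z + bd_count G (flags G - Z) = C"
    using assms(1) by (auto simp: uniform_bd_def)
  obtain D where D: "\<And>Z. edge_closed H Z \<Longrightarrow> bd_count H Z + bd_count H (flags H - Z) = D"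
    using assms(2) by (auto simp: uniform_bd_def)
  have "bd_count K Z + bd_count K (flags K - Z) = C + D - 2" if "edge_closed K Z" for Z
    using bd_count_sum_K[OF that] C D that unfolding edge_closed_K by fastforce
  then show ?thesis unfolding uniform_bd_def by blast
qed

end

section \<open>Ribbon-joins of odd bouquets have constant sums\<close>

lemma is_B_uniform:
  assumes B: "is_B m K" and m: "odd m"
  shows "is_ribbon_graph K \<and> orientable_rg K \<and> flags K \<noteq> {} \<and> isolated K = 0 \<and> uniform_bd K"
proof -
  have rg: "is_ribbon_graph K" and ori: "orientable_rg K" and v: "num_vertices K = 1"
    and E: "card (edges K) = m" and il: "pairwise (interlaced K) (edges K)"
    using B by (auto simp: is_B_def)
  obtain c where "oriented_rg K c"
    using ori rg unfolding orientable_rg_def oriented_rg_def by blast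
  then interpret oriented_rg K c .
  \<comment> \<open>An odd number of edges is not zero; hence the single vertex-disc carries flags
    and is not an isolated one.\<close>
  have ne: "flags K \<noteq> {}" using E m by (auto simp: edges_eq)
  have "bd_count K {} = 1" "isolated K = 0"
    using v bd_count_pos[OF ne, of "{}"] by (auto simp: num_vertices_eq)
  then interpret bouquet K c using ne by unfold_locales
  have "uniform_bd K"
    using all_linked_uniform_iff all_linked_iff_interlaced il E m by blast
  then show ?thesis using rg ori ne \<open>isolated K = 0\<close> by blast
qed

text \<open>Carrying \<open>isolated H = 0\<close> through the induction rules out the gluing of
  isolated discs, so every join is a gluing of arcs.\<close>

lemma ribbon_joins_uniform:
  assumes "H \<in> ribbon_joins_of {K. \<exists>n. odd n \<and> is_B n K}"
  shows "is_ribbon_graph H \<and> orientable_rg H \<and> flags H \<noteq> {} \<and> isolated H = 0 \<and> uniform_bd H"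
  using assms
proof induction
  case (base G)
  then show ?case using is_B_uniform by blast
next
  case (join G H K)
  from join.hyps(3) show ?case
  proof cases
    case (arcs x y)
    then interpret glue: gluing G H x y
      using join.IH unfolding gluing_def by blast
    have "K = glue.K" using arcs(1) by (simp add: glue.K_def)
    moreover have "flags glue.K \<noteq> {}" "isolated glue.K = 0"
      using join.IH by (simp_all add: glue.K_def)
    ultimately show ?thesis
      using glue.is_ribbon_graph_K glue.orientable_K glue.uniform_K join.IH by simp
  next
    case disc
    then show ?thesis using join.IH by simp
  qed
qed

section \<open>Genus and coefficients in terms of component counts\<close>

definition bd_sum :: "'a ribbon_graph \<Rightarrow> 'a set \<Rightarrow> nat" where
  "bd_sum G Z = bd_count G Z + bd_count G (flags G - Z)"

lemma genus_partial_dual: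
  "genus (partial_dual G A) = nat ((2 * int (num_components G) + int (card (edges G))
     - 2 * int (isolated G) - int (bd_sum G (\<Union>A))) div 2)"
proof -
  have "euler_genus (partial_dual G A) = 2 * int (num_components G) + int (card (edges G))
     - 2 * int (isolated G) - int (bd_sum G (\<Union>A))"
    unfolding euler_genus_def num_vertices_partial_dual num_faces_partial_dual edges_partial_dual
      num_components_partial_dual bd_sum_def by simp
  then show ?thesis by (simp add: genus_def)
qed

lemma coeff_partial_dual_genus_poly:
  assumes "finite (edges G)"
  shows "coeff (partial_dual_genus_poly G) k =
    int (card {A \<in> Pow (edges G). genus (partial_dual G A) = k})"
proof -
  have "coeff (partial_dual_genus_poly G) k =
      (\<Sum>A\<in>Pow (edges G). if genus (partial_dual G A) = k then 1 else 0)"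
    by (simp add: partial_dual_genus_poly_def coeff_sum)
  also have "\<dots> = int (card {A \<in> Pow (edges G). genus (partial_dual G A) = k})"
    using assms by (subst sum.inter_filter[symmetric]) simp_all
  finally show ?thesis .
qed

text \<open>The coefficients count partial duals, so nothing cancels, and a coefficient is non-zero
  exactly when its exponent occurs as a genus.\<close>

lemma single_coeff_iff:
  assumes fin: "finite (edges G)"
  shows "(\<exists>!k. coeff (partial_dual_genus_poly G) k \<noteq> 0) \<longleftrightarrow>
    (\<exists>k. \<forall>A\<subseteq>edges G. genus (partial_dual G A) = k)"
proof -
  have nz: "coeff (partial_dual_genus_poly G) k \<noteq> 0 \<longleftrightarrow> (\<exists>A\<subseteq>edges G. genus (partial_dual G A) = k)"
    for k
    using fin by (auto simp: coeff_partial_dual_genus_poly card_eq_0_iff)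
  show ?thesis unfolding nz
  proof
    assume ex1: "\<exists>!k. \<exists>A\<subseteq>edges G. genus (partial_dual G A) = k"
    have "genus (partial_dual G A) = genus (partial_dual G {})" if A: "A \<subseteq> edges G" for A
      using ex1 A by (elim ex1E) (metis (mono_tags) empty_subsetI)
    then show "\<exists>k. \<forall>A\<subseteq>edges G. genus (partial_dual G A) = k" by blast
  next
    assume "\<exists>k. \<forall>A\<subseteq>edges G. genus (partial_dual G A) = k"
    then obtain k where k: "\<forall>A\<subseteq>edges G. genus (partial_dual G A) = k" ..
    show "\<exists>!k. \<exists>A\<subseteq>edges G. genus (partial_dual G A) = k"
    proof (rule ex1I)
      show "\<exists>A\<subseteq>edges G. genus (partial_dual G A) = k" using k by (intro exI[of _ "{}"]) simp
    qed (use k in blast)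
  qed
qed

section \<open>Decomposing bouquets into ribbon-joins\<close>

context gluing
begin

lemma bd_count_empty_K:
  assumes "bd_count K {} = 1" "bd_count G {} > 0" "bd_count H {} > 0"
  shows "bd_count G {} = 1" "bd_count H {} = 1"
  using bd_count_K[of "{}" "{}"] assms by (simp_all add: edge_closed_def)

text \<open>Edges are varied in one summand only, while the other contributes its fixed sum at the
  empty set.\<close>

lemma uniform_parts:
  assumes "uniform_bd K"
  shows "uniform_bd G" "uniform_bd H"
proof -
  obtain C where C: "\<And>Z. edge_closed K Z \<Longrightarrow> bd_count K Z + bd_count K (flags K - Z) = C"
    using assms by (auto simp: uniform_bd_def)
  have "bd_count G Z + bd_count G (flags G - Z) = C + 2 - (bd_count H {} + bd_count H (flags H))"
    if Z: "edge_closed G Z" for Z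
  proof -
    have ZG: "Z \<inter> flags G = Z" "Z \<inter> flags H = {}" using Z disj by (auto simp: edge_closed_def)
    then have "edge_closed K Z"
      using Z unfolding edge_closed_K by (auto simp: edge_closed_def K_def)
    from bd_count_sum_K[OF this] C[OF this] show ?thesis unfolding ZG by simp
  qed
  then show "uniform_bd G" unfolding uniform_bd_def by blast
  have "bd_count H Z + bd_count H (flags H - Z) = C + 2 - (bd_count G {} + bd_count G (flags G))"
    if Z: "edge_closed H Z" for Z
  proof -
    have ZH: "Z \<inter> flags H = Z" "Z \<inter> flags G = {}" using Z disj by (auto simp: edge_closed_def)
    then have "edge_closed K Z"
      using Z unfolding edge_closed_K by (auto simp: edge_closed_def K_def)
    from bd_count_sum_K[OF this] C[OF this] show ?thesis unfolding ZH by simp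
  qed
  then show "uniform_bd H" unfolding uniform_bd_def by blast
qed

end

text \<open>Equality up to the meaningless values outside the flags. Unlike an isomorphism it keeps
  flags and edges literally the same.\<close>

definition same_on_flags :: "'a ribbon_graph \<Rightarrow> 'a ribbon_graph \<Rightarrow> bool" where
  "same_on_flags G H \<longleftrightarrow> flags G = flags H \<and> isolated G = isolated H \<and>
     (\<forall>x\<in>flags H. tau_end G x = tau_end H x \<and> tau_side G x = tau_side H x \<and>
       tau_arc G x = tau_arc H x)"

lemma same_on_flags_edges:
  assumes "same_on_flags G H" shows "edges G = edges H"
proof -
  have "reach {tau_end G, tau_side G} (flags H) = reach {tau_end H, tau_side H} (flags H)"
    using assms by (intro reach_cong) (auto simp: same_on_flags_def)
  then show ?thesis using assms by (simp add: edges_def orbits_def same_on_flags_def)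
qed

lemma same_on_flags_bd_count:
  assumes "same_on_flags G H" shows "bd_count G Z = bd_count H Z"
proof -
  have "reach {swap_sides G Z, tau_arc G} (flags H) = reach {swap_sides H Z, tau_arc H} (flags H)"
    using assms by (intro reach_cong) (auto simp: same_on_flags_def swap_sides_def)
  then show ?thesis using assms by (simp add: bd_count_def bd_rel_def same_on_flags_def)
qed

lemma same_on_flags_edge_closed:
  assumes "same_on_flags G H" shows "edge_closed G Z \<longleftrightarrow> edge_closed H Z"
  using assms unfolding same_on_flags_def edge_closed_def by (metis subsetD)

lemma same_on_flags_uniform:
  assumes "same_on_flags G H" shows "uniform_bd G \<longleftrightarrow> uniform_bd H"
proof -
  have "flags G = flags H" using assms by (simp add: same_on_flags_def)
  then show ?thesis
    unfolding uniform_bd_def same_on_flags_bd_count[OF assms] same_on_flags_edge_closed[OF assms]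
    by simp
qed

lemma same_on_flags_glue:
  assumes G: "same_on_flags G G'" and H: "same_on_flags H H'"
    and x: "x \<in> flags G'" and y: "y \<in> flags H'"
  shows "same_on_flags (glue_arcs G x H y) (glue_arcs G' x H' y)"
proof -
  have f: "flags G = flags G'" "flags H = flags H'" "isolated G = isolated G'" "isolated H = isolated H'"
    using G H by (auto simp: same_on_flags_def)
  have g: "tau_end G z = tau_end G' z" "tau_side G z = tau_side G' z" "tau_arc G z = tau_arc G' z"
    if "z \<in> flags G'" for z using G that by (auto simp: same_on_flags_def)
  have h: "tau_end H z = tau_end H' z" "tau_side H z = tau_side H' z" "tau_arc H z = tau_arc H' z"
    if "z \<in> flags H'" for z using H that by (auto simp: same_on_flags_def)
  have "tau_arc (glue_arcs G x H y) z = tau_arc (glue_arcs G' x H' y) z"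
    if "z \<in> flags G' \<union> flags H'" for z
    using that g(3) h(3) g(3)[OF x] h(3)[OF y]
    by (auto simp: glue_arcs_def disjoint_union_rg_def Let_def f)
  then show ?thesis unfolding same_on_flags_def using f g h by auto
qed

context bouquet
begin

lemma linked_ed: "x \<in> X \<Longrightarrow> y \<in> X \<Longrightarrow> z \<in> ed y \<Longrightarrow> linked x z \<longleftrightarrow> linked x y"
  using ed_eq[of y z] unfolding linked_def by simp

text \<open>The first part of the vertex circle that lies between two consecutive ends of the edges
  linked to \<open>x\<close> contains both ends of each edge that it meets, and can be cut off.\<close>

lemma split_off:
  assumes u: "uniform_bd G" and x: "x \<in> X" and nl: "\<exists>y\<in>X. \<not> linked x y"
  obtains Y a b where "Y \<subset> X" "edge_closed G Y" "a \<in> X - Y" "b \<in> X - Y" "\<alpha> a \<in> Y" "\<alpha> b \<in> Y"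
    "c b \<noteq> c a" "\<And>z. z \<in> Y \<Longrightarrow> \<alpha> z \<in> Y \<union> {a, b}"
proof -
  define Z where "Z = {y \<in> X. linked x y}"
  have ecZ: "ec Z"
  proof (rule edge_closedI)
    fix z assume "z \<in> Z"
    then have z: "z \<in> X" "linked x z" by (simp_all add: Z_def)
    then show "\<epsilon> z \<in> Z" "\<sigma> z \<in> Z"
      using linked_ed[OF x z(1) end_in_ed] linked_ed[OF x z(1) side_in_ed]
      by (simp_all add: Z_def flag_simps)
  qed (auto simp: Z_def)
  have ZX: "Z \<subseteq> X" by (auto simp: Z_def)
  have xZ: "x \<in> Z" using x by (simp add: Z_def linked_def)
  \<comment> \<open>Otherwise the class would be closed under both steps of the vertex circle and
    contain every flag.\<close>
  have "\<exists>a\<in>Z. \<alpha> a \<notin> Z"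
  proof (rule ccontr)
    assume cl: "\<not> (\<exists>a\<in>Z. \<alpha> a \<notin> Z)"
    have "y \<in> Z" if "y \<in> X" for y
    proof -
      have "(x, y) \<in> reach {swap_sides G {}, \<alpha>} X" using R_empty[OF x that] by (simp add: bd_rel_def)
      then show ?thesis
      proof (rule reach_closed[OF _ xZ])
        fix u t assume "u \<in> Z" "u \<in> X" "t \<in> {swap_sides G {}, \<alpha>}"
        then show "t u \<in> Z" using cl ecZ by (auto simp: swap_sides_def edge_closed_def)
      qed
    qed
    then show False using nl by (auto simp: Z_def)
  qed
  then obtain a where a: "a \<in> Z" "\<alpha> a \<notin> Z" by blast
  have aX: "a \<in> X" using a ZX by auto
  have end_fpf: "fpf_involution_on X \<epsilon>" by (simp add: fpf_involution_on_def flag_simps)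
  \<comment> \<open>The walk leaves the class at \<open>a\<close>, goes along the vertex circle and
    stops at its first return to the class, at \<open>b\<close>.\<close>
  obtain W b where W: "W \<subseteq> X" "W \<inter> Z = {a, b}" "c b \<noteq> c a"
    "\<And>z. z \<in> W \<Longrightarrow> \<alpha> z \<in> W" "\<And>z. z \<in> W - Z \<Longrightarrow> \<epsilon> z \<in> W"
  proof (rule excursion[where c = c, OF fin end_fpf arc_fpf _ _ ZX _ a(1)])
    show "c (\<epsilon> z) \<noteq> c z" "c (\<alpha> z) \<noteq> c z" if "z \<in> X" for z using col that by auto
    show "\<epsilon> z \<in> Z" if "z \<in> Z" for z using ecZ that by (simp add: edge_closed_def)
  qed (rule that)
  have bX: "b \<in> X" and bW: "b \<in> W" and bZ: "b \<in> Z" and aW: "a \<in> W" using W by auto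
  let ?Y = "W - Z"
  have aa: "\<alpha> a \<in> ?Y" using W(4)[OF aW] a by simp
  have "\<alpha> b \<notin> Z"
  proof
    assume "\<alpha> b \<in> Z"
    then have "\<alpha> b \<in> {a, b}" using W(2) W(4)[OF bW] by blast
    then have "\<alpha> b = a" using arc_flag(2)[OF bX] by simp
    then have "\<alpha> a = b" using arc_flag(3)[OF bX] by simp
    then show False using a bZ by simp
  qed
  then have ab: "\<alpha> b \<in> ?Y" using W(4)[OF bW] by simp
  \<comment> \<open>The other end of an edge met in the gap is reached along the vertex circle
    without meeting the class, hence within the gap. Transitivity of \<open>linked\<close> supplies
    that \<open>Z\<close> is pairwise linked and not linked to \<open>z\<close>.\<close>
  have side: "\<sigma> z \<in> ?Y" if z: "z \<in> ?Y" for z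
  proof -
    have zX: "z \<in> X" and nz: "\<not> linked x z" using z W(1) by (auto simp: Z_def)
    have "(z, \<sigma> z) \<in> reach {\<epsilon>, \<alpha>} (X - Z)"
    proof (rule side_reach_off_linked_set[OF zX ZX ecZ])
      show "\<not> linked z w" if "w \<in> Z" for w
        using that linked_trans[OF u x _ zX, of w] linked_sym nz by (auto simp: Z_def)
      show "linked w w'" if "w \<in> Z" "w' \<in> Z" for w w'
        using that linked_trans[OF u _ x, of w w'] linked_sym by (auto simp: Z_def)
    qed
    then show ?thesis
    proof (rule reach_closed[OF _ z])
      fix u t assume "u \<in> ?Y" "t \<in> {\<epsilon>, \<alpha>}" "t u \<in> X - Z"
      then show "t u \<in> ?Y" using W(4,5) by auto
    qed
  qed
  show ?thesis
  proof (rule that[of ?Y a b])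
    show "?Y \<subset> X" using W(1) aX a by auto
    show "ec ?Y"
    proof (rule edge_closedI)
      fix z assume z: "z \<in> ?Y"
      then show "\<sigma> z \<in> ?Y" by (rule side)
      show "\<epsilon> z \<in> ?Y" using W(1) W(5)[OF z] ec_mem(1)[OF ecZ, of z] z by auto
    qed (use W(1) in auto)
    show "a \<in> X - ?Y" "b \<in> X - ?Y" using aX bX a bZ by auto
    show "\<alpha> a \<in> ?Y" "\<alpha> b \<in> ?Y" by fact+
    show "c b \<noteq> c a" by fact
    show "\<alpha> z \<in> ?Y \<union> {a, b}" if "z \<in> ?Y" for z using W(2) W(4)[of z] that by auto
  qed
qed

end

text \<open>The part of \<open>G\<close> on the flags \<open>Y\<close>, when only the arcs at \<open>p\<close> and \<open>q\<close> leave \<open>Y\<close>.\<close>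

definition cut_part :: "'a ribbon_graph \<Rightarrow> 'a set \<Rightarrow> 'a \<Rightarrow> 'a \<Rightarrow> 'a ribbon_graph" where
  "cut_part G Y p q = G\<lparr>flags := Y, tau_arc := (tau_arc G)(p := q, q := p)\<rparr>"

text \<open>The two loose ends of arcs are joined to each other; \<open>c p \<noteq> c q\<close>
  makes the new arc compatible with the colouring.\<close>

lemma (in oriented_rg) oriented_rg_cut_part:
  assumes Y: "edge_closed G Y" and pq: "p \<in> Y" "q \<in> Y" "c p \<noteq> c q" "\<alpha> p \<notin> Y" "\<alpha> q \<notin> Y"
    and arc: "\<And>z. z \<in> Y \<Longrightarrow> z \<noteq> p \<Longrightarrow> z \<noteq> q \<Longrightarrow> \<alpha> z \<in> Y"
  shows "oriented_rg (cut_part G Y p q) c"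
proof -
  have YX: "Y \<subseteq> X" using ec_subset[OF Y] .
  have ne: "p \<noteq> q" using pq(3) by auto
  have av: "((tau_arc G)(p := q, q := p)) z = (if z = p then q else if z = q then p else \<alpha> z)" for z
    using ne by simp
  have "fpf_involution_on Y ((tau_arc G)(p := q, q := p))"
    unfolding fpf_involution_on_def
  proof
    fix z assume z: "z \<in> Y"
    let ?t = "(tau_arc G)(p := q, q := p)"
    show "?t z \<in> Y \<and> ?t z \<noteq> z \<and> ?t (?t z) = z"
    proof (cases "z = p \<or> z = q")
      case True
      then show ?thesis unfolding av using pq(1,2) ne by auto
    next
      case False
      have zX: "z \<in> X" using z YX by auto
      have "\<alpha> z \<noteq> p" "\<alpha> z \<noteq> q" using pq(4,5) arc_flag(3)[OF zX] z by auto
      then show ?thesis unfolding av using False arc[OF z] arc_flag[OF zX] by simp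
    qed
  qed
  moreover have "finite Y" using fin YX finite_subset by blast
  moreover have "fpf_involution_on Y \<epsilon>" "fpf_involution_on Y \<sigma>"
    using Y YX flag_simps[OF subsetD[OF YX]] by (simp_all add: fpf_involution_on_def edge_closed_def)
  moreover have "\<And>z. z \<in> Y \<Longrightarrow> \<epsilon> (\<sigma> z) = \<sigma> (\<epsilon> z) \<and> \<epsilon> z \<noteq> \<sigma> z"
    using side_end[OF subsetD[OF YX]] end_ne_side[OF subsetD[OF YX]] by simp
  ultimately have "is_ribbon_graph (cut_part G Y p q)"
    unfolding is_ribbon_graph_def cut_part_def by simp
  moreover have "c (tau_arc (cut_part G Y p q) z) \<noteq> c z" if "z \<in> Y" for z
    using that pq(3) col[of z] YX unfolding cut_part_def by (auto simp: av)
  ultimately show ?thesis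
    unfolding oriented_rg_def using col YX by (auto simp: cut_part_def)
qed

lemma is_B_bouquet:
  assumes "bouquet G c" "isolated G = 0" "\<And>x y. x \<in> flags G \<Longrightarrow> y \<in> flags G \<Longrightarrow> bouquet.linked G x y"
  shows "is_B (card (edges G)) G"
proof -
  interpret bouquet G c by fact
  have "orientable_rg G" unfolding orientable_rg_def using col by blast
  moreover have "num_vertices G = 1" using one assms(2) by (simp add: num_vertices_eq)
  ultimately show ?thesis
    unfolding is_B_def using rg all_linked_iff_interlaced assms(3) by blast
qed

text \<open>A gap at an equivalence class cuts the graph into two bouquets with fewer flags, both
  with constant sums. The induction ends at bouquets consisting of a single class.\<close>

lemma uniform_bouquet_is_join:
  assumes "bouquet G c" "uniform_bd G" "isolated G = 0"
  shows "\<exists>H\<in>ribbon_joins_of {K. \<exists>n. odd n \<and> is_B n K}. same_on_flags H G"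
  using assms
proof (induction "card (flags G)" arbitrary: G rule: less_induct)
  case less
  let ?J = "ribbon_joins_of {K. \<exists>n. odd n \<and> is_B n K}"
  note u = less.prems(2) and iso = less.prems(3)
  interpret bouquet G c by (rule less.prems)
  obtain x where x: "x \<in> X" using nonempty by blast
  show ?case
  proof (cases "\<forall>y\<in>X. linked x y")
    case True
    then have all: "linked y z" if "y \<in> X" "z \<in> X" for y z
      using linked_trans[OF u that(1) x that(2)] linked_sym that by blast
    then have "is_B (card (edges G)) G" "odd (card (edges G))"
      using is_B_bouquet[OF less.prems(1) iso] all_linked_uniform_iff u by blast+
    then have "G \<in> ?J" by (intro ribbon_joins_of.base) blast
    moreover have "same_on_flags G G" by (simp add: same_on_flags_def)
    ultimately show ?thesis by blast
  next
    case False
    then obtain Y a b where Y: "Y \<subset> X" "edge_closed G Y" "a \<in> X - Y" "b \<in> X - Y" "\<alpha> a \<in> Y" "\<alpha> b \<in> Y"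
      "c b \<noteq> c a" "\<And>z. z \<in> Y \<Longrightarrow> \<alpha> z \<in> Y \<union> {a, b}"
      using split_off[OF u x] by blast
    let ?p = "\<alpha> a" and ?q = "\<alpha> b"
    have aX: "a \<in> X" and bX: "b \<in> X" using Y by auto
    have pa: "\<alpha> ?p = a" and qb: "\<alpha> ?q = b" using arc_flag(3) aX bX by auto
    define G1 where "G1 = cut_part G (X - Y) a b"
    define G2 where "G2 = cut_part G Y ?p ?q"
    have "oriented_rg G1 c"
      unfolding G1_def
    proof (rule oriented_rg_cut_part)
      show "ec (X - Y)" using ec_Diff Y(2) by simp
      fix z assume z: "z \<in> X - Y" "z \<noteq> a" "z \<noteq> b"
      then show "\<alpha> z \<in> X - Y" using Y(8)[of "\<alpha> z"] arc_flag by auto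
    qed (use Y in auto)
    then interpret G1: oriented_rg G1 c .
    have "oriented_rg G2 c"
      unfolding G2_def
    proof (rule oriented_rg_cut_part)
      show "c ?p \<noteq> c ?q" using Y(7) col aX bX by auto
      fix z assume z: "z \<in> Y" "z \<noteq> ?p" "z \<noteq> ?q"
      then have "z \<in> X" using Y(1) by auto
      then show "\<alpha> z \<in> Y" using Y(8)[OF z(1)] z arc_flag(3) by auto
    qed (use Y pa qb in auto)
    then interpret G2: oriented_rg G2 c .
    have f1: "flags G1 = X - Y" and f2: "flags G2 = Y" by (simp_all add: G1_def G2_def cut_part_def)
    interpret glue: gluing G1 G2 a ?p
      using G1.rg G2.rg Y by unfold_locales (auto simp: f1 f2)
    \<comment> \<open>Cutting has replaced the arcs from \<open>a\<close> to
      \<open>\<alpha> a\<close> and from \<open>b\<close> to \<open>\<alpha> b\<close> by arcs from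
      \<open>a\<close> to \<open>b\<close> and from \<open>\<alpha> a\<close> to
      \<open>\<alpha> b\<close>. Gluing at \<open>a\<close> and \<open>\<alpha> a\<close> reverses
      this.\<close>
    have a1: "tau_arc G1 a = b" and p2: "tau_arc G2 ?p = ?q"
      using Y(7) arc_flag(3)[OF aX] arc_flag(3)[OF bX] by (auto simp: G1_def G2_def cut_part_def)
    have K: "same_on_flags glue.K G"
      unfolding same_on_flags_def
    proof (intro conjI ballI)
      show "flags glue.K = X" using Y(1) by (auto simp: glue.K_def f1 f2)
      show "isolated glue.K = isolated G" using iso unfolding glue.K_def by (simp add: G1_def G2_def cut_part_def)
      fix z assume z: "z \<in> X"
      show "tau_end glue.K z = \<epsilon> z" "tau_side glue.K z = \<sigma> z"
        unfolding glue.K_def by (simp_all add: G1_def G2_def cut_part_def)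
      show "tau_arc glue.K z = \<alpha> z"
      proof (cases "z \<in> {a, ?p, b, ?q}")
        case True
        then consider "z = a" | "z = ?p" | "z = b" | "z = ?q" by blast
        then show ?thesis
          using glue.K_arc(1-4) by cases (simp_all add: a1 p2 pa qb)
      next
        case False
        then have "tau_arc glue.K z = glue.arcs z" using glue.K_arc(5)[of z] by (simp add: a1 p2)
        then show ?thesis using False unfolding glue.arcs_def by (simp add: G1_def G2_def cut_part_def)
      qed
    qed
    have ne: "flags G1 \<noteq> {}" "flags G2 \<noteq> {}" using Y by (auto simp: f1 f2)
    \<comment> \<open>The two positive vertex counts of the parts add up to two, so each part has
      one vertex.\<close>
    have "bd_count glue.K {} = 1" using same_on_flags_bd_count[OF K] one by simp
    from glue.bd_count_empty_K[OF this G1.bd_count_pos[OF ne(1)] G2.bd_count_pos[OF ne(2)]]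
    have "bouquet G1 c" "bouquet G2 c" using ne by unfold_locales
    moreover have "uniform_bd G1" "uniform_bd G2"
      using glue.uniform_parts u same_on_flags_uniform[OF K] by blast+
    moreover have "isolated G1 = 0" "isolated G2 = 0" using iso by (simp_all add: G1_def G2_def cut_part_def)
    moreover have "card (flags G1) < card X" "card (flags G2) < card X"
      unfolding f1 f2 using Y(1,5) fin by (auto intro!: psubset_card_mono)
    ultimately obtain H1 H2 where H: "H1 \<in> ?J" "same_on_flags H1 G1" "H2 \<in> ?J" "same_on_flags H2 G2"
      using less.hyps[of G1] less.hyps[of G2] by blast
    have fl: "flags H1 = flags G1" "flags H2 = flags G2" using H(2,4) by (simp_all add: same_on_flags_def)
    have "glue_arcs H1 a H2 ?p \<in> ?J"
      using H(1,3) glue.disj glue.xG glue.yH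
      by (intro ribbon_joins_of.join[OF H(1,3)] ribbon_join.arcs) (simp_all add: fl)
    moreover have "same_on_flags (glue_arcs H1 a H2 ?p) glue.K"
      unfolding glue.K_def by (rule same_on_flags_glue[OF H(2,4) glue.xG glue.yH])
    then have "same_on_flags (glue_arcs H1 a H2 ?p) G" using K unfolding same_on_flags_def by auto
    ultimately show ?thesis by blast
  qed
qed

section \<open>Partial-dual genus\<close>

context oriented_rg
begin

lemma bd_sum_parity:
  assumes A: "A \<subseteq> edges G"
  shows "even (bd_sum G (\<Union>A) + card (edges G))"
proof -
  have "card A + card (edges G - A) = card (edges G)"
    using A finite_edges card_Diff_subset[of A "edges G"] card_mono[of "edges G" A]
    by (simp add: finite_subset)
  moreover have "even (n (\<Union>A) + n {} + card A)" using bd_count_parity[OF A] .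
  moreover have "even (n (X - \<Union>A) + n {} + card (edges G - A))"
    using bd_count_parity[of "edges G - A"] Diff_Union_edges[OF A] by simp
  ultimately have "even (n (\<Union>A) + n {} + card A + (n (X - \<Union>A) + n {} + card (edges G - A)))"
    by (metis even_add)
  moreover have "n (\<Union>A) + n {} + card A + (n (X - \<Union>A) + n {} + card (edges G - A)) =
      bd_sum G (\<Union>A) + card (edges G) + 2 * n {}"
    unfolding bd_sum_def using \<open>card A + card (edges G - A) = card (edges G)\<close> by simp
  ultimately show ?thesis by simp
qed

text \<open>Halving the Euler genus loses nothing, as its parity is fixed, and the truncation at \<open>0\<close> does
  not matter when the genus is positive.\<close>

lemma uniform_bd_if_genus_constant:
  assumes g: "\<And>A. A \<subseteq> edges G \<Longrightarrow> genus (partial_dual G A) = k" and k: "k > 0"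
  shows "uniform_bd G"
proof -
  define N where "N = 2 * int (num_components G) + int (card (edges G)) - 2 * int (isolated G)"
  have half: "(N - int (bd_sum G (\<Union>A))) div 2 = int k" if A: "A \<subseteq> edges G" for A
    using g[OF A] k unfolding genus_partial_dual N_def by linarith
  have "bd_sum G (\<Union>A) = bd_sum G {}" if A: "A \<subseteq> edges G" for A
  proof -
    have "even (bd_sum G (\<Union>A) + card (edges G))" "even (bd_sum G {} + card (edges G))"
      using bd_sum_parity[OF A] bd_sum_parity[of "{}"] by auto
    then have "even (int (bd_sum G (\<Union>A)) - int (bd_sum G {}))" by auto
    moreover have "(N - int (bd_sum G (\<Union>A))) div 2 = (N - int (bd_sum G {})) div 2"
      using half[OF A] half[of "{}"] by simp
    ultimately show ?thesis by presburger
  qed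
  then have "n Z + n (X - Z) = bd_sum G {}" if "ec Z" for Z
    using edge_closed_eq_Union[OF that] unfolding bd_sum_def
    by (metis (no_types, lifting) mem_Collect_eq subsetI)
  then show ?thesis unfolding uniform_bd_def by blast
qed

lemma genus_constant_if_uniform_bd:
  assumes "uniform_bd G"
  shows "\<exists>k. \<forall>A\<subseteq>edges G. genus (partial_dual G A) = k"
proof -
  obtain C where C: "\<And>Z. ec Z \<Longrightarrow> bd_sum G Z = C"
    using assms unfolding uniform_bd_def bd_sum_def by blast
  have "genus (partial_dual G A) = genus (partial_dual G {})" if A: "A \<subseteq> edges G" for A
    using C[OF ec_Union_edges[OF A]] C[of "{}"] by (simp add: genus_partial_dual)
  then show ?thesis by blast
qed

lemma connected_flags:
  assumes conn: "connected_rg G" and ne: "X \<noteq> {}"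
  shows "isolated G = 0" "\<And>x y. x \<in> X \<Longrightarrow> y \<in> X \<Longrightarrow> (x, y) \<in> reach {\<epsilon>, \<sigma>, \<alpha>} X"
proof -
  let ?r = "reach {\<epsilon>, \<sigma>, \<alpha>} X"
  have fq: "finite (X // ?r)" using fin by (simp add: quotient_def)
  have "X // ?r \<noteq> {}" using ne by (auto simp: quotient_def)
  then have "card (X // ?r) > 0" using fq by (simp add: card_gt_0_iff)
  then have c: "card (X // ?r) = 1" "isolated G = 0"
    using conn by (auto simp: connected_rg_def num_components_def orbits_def)
  then show "isolated G = 0" by simp
  obtain S where S: "X // ?r = {S}" using c(1) by (auto simp: card_1_singleton_iff)
  fix x y assume "x \<in> X" "y \<in> X"
  then have "?r `` {x} = S" "?r `` {y} = S" using S quotientI[of _ X ?r] by blast+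
  then show "(x, y) \<in> ?r" by (metis Image_singleton_iff reach_refl)
qed

text \<open>Toggling an edge that joins two different vertex-discs of a partial dual merges them.\<close>

lemma ex_one_vertex_partial_dual:
  assumes conn: "connected_rg G" and ne: "X \<noteq> {}"
  obtains Z where "ec Z" "n Z = 1"
proof -
  obtain Z where Z: "ec Z" "\<And>Z'. ec Z' \<Longrightarrow> n Z \<le> n Z'"
    using ex_has_least_nat[of ec "{}" n] ec_empty by blast
  have "n Z = 1"
  proof (rule ccontr)
    assume "n Z \<noteq> 1"
    then obtain x y where xy: "x \<in> X" "y \<in> X" "(x, y) \<notin> R Z"
      using bd_count_eq_1_iff[OF Z(1) ne] by auto
    \<comment> \<open>If no edge met two different components, connectedness of the graph would
      leave only one component.\<close>
    have "\<exists>z\<in>X. (z, \<epsilon> z) \<notin> R Z \<or> (z, \<sigma> z) \<notin> R Z"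
    proof (rule ccontr)
      assume "\<not> ?thesis"
      then have st: "(z, \<epsilon> z) \<in> R Z" "(z, \<sigma> z) \<in> R Z" if "z \<in> X" for z using that by auto
      have "reach {\<epsilon>, \<sigma>, \<alpha>} X \<subseteq> R Z"
      proof (rule reach_subset)
        show "(z, t z) \<in> R Z" if "t \<in> {\<epsilon>, \<sigma>, \<alpha>}" "z \<in> X" for t z
          using that st R_arc by auto
      qed (use equiv_R[OF Z(1)] in \<open>auto elim: equivE\<close>)
      then show False using connected_flags(2)[OF conn ne xy(1,2)] xy(3) by blast
    qed
    then obtain z where z: "z \<in> X" "(z, \<epsilon> z) \<notin> R Z \<or> (z, \<sigma> z) \<notin> R Z" by blast
    have ecz: "ec (ed z)" using ec_ed z by blast
    show False
    \<comment> \<open>The boundary follows the free sides of the edges in \<open>Z\<close> and the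
      ends of the others. So the separated pair is the one that toggling the edge links up.\<close>
    proof (cases "z \<in> Z")
      case True
      let ?Z = "Z - ed z"
      have "?Z \<union> ed z = Z" using ed_subset[OF Z(1) True] by auto
      moreover have "(z, \<epsilon> z) \<notin> R Z" using z R_side[OF True] by auto
      ultimately have "n Z = Suc (n ?Z)"
        using toggle[OF ec_Diff[OF Z(1) ecz] z(1)] by auto
      then show False using Z(2)[OF ec_Diff[OF Z(1) ecz]] by simp
    next
      case False
      have "(z, \<sigma> z) \<notin> R Z" using z R_end[OF _ False] by auto
      then have "n Z = Suc (n (Z \<union> ed z))" using toggle[OF Z(1) z(1) False] by auto
      then show False using Z(2)[OF ec_Un[OF Z(1) ecz]] by simp
    qed
  qed
  then show ?thesis using that Z(1) by blast
qed

text \<open>Only the roles of ends and sides are exchanged, and \<open>c\<close> alternates along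
  both, so the same colouring serves.\<close>

lemma oriented_rg_partial_dual:
  assumes A: "A \<subseteq> edges G"
  shows "oriented_rg (partial_dual G A) c"
proof
  have ecA: "ec (\<Union>A)" using ec_Union_edges[OF A] .
  have e: "tau_end (partial_dual G A) = swap_sides G (\<Union>A)"
    by (rule ext) (simp add: partial_dual_def swap_sides_def)
  have XA: "X - (X - \<Union>A) = \<Union>A" using ec_subset[OF ecA] by auto
  have s: "tau_side (partial_dual G A) x = swap_sides G (X - \<Union>A) x" if "x \<in> X" for x
    using that by (simp add: partial_dual_def swap_sides_def)
  have fl: "flags (partial_dual G A) = X" "tau_arc (partial_dual G A) = \<alpha>"
    by (simp_all add: partial_dual_def)
  have sf: "fpf_involution_on X (tau_side (partial_dual G A))"
    using swap_fpf[OF ec_Diff[OF ec_flags ecA]] s unfolding fpf_involution_on_def by simp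
  have mem: "\<epsilon> x \<in> \<Union>A \<longleftrightarrow> x \<in> \<Union>A" "\<sigma> x \<in> \<Union>A \<longleftrightarrow> x \<in> \<Union>A" if "x \<in> X" for x
    using ec_mem[OF ecA that] .
  have comm: "tau_end (partial_dual G A) (tau_side (partial_dual G A) x) =
      tau_side (partial_dual G A) (tau_end (partial_dual G A) x)"
    "tau_end (partial_dual G A) x \<noteq> tau_side (partial_dual G A) x" if x: "x \<in> X" for x
    using mem[OF x] side_end[OF x] end_ne_side[OF x]
    by (cases "x \<in> \<Union>A"; simp add: partial_dual_def)+
  show "is_ribbon_graph (partial_dual G A)"
    unfolding is_ribbon_graph_def fl using fin swap_fpf[OF ecA] sf arc_fpf comm e by simp
  show "c (tau_end (partial_dual G A) x) \<noteq> c x \<and> c (tau_side (partial_dual G A) x) \<noteq> c x \<and>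
      c (tau_arc (partial_dual G A) x) \<noteq> c x" if "x \<in> flags (partial_dual G A)" for x
    using that col[of x] by (simp add: partial_dual_def)
qed

text \<open>Taking the symmetric difference with \<open>\<Union>A\<close> commutes with
  complementation, so the dual has the same sums.\<close>

lemma uniform_partial_dual:
  assumes u: "uniform_bd G" and A: "A \<subseteq> edges G"
  shows "uniform_bd (partial_dual G A)"
proof -
  obtain C where C: "\<And>Z. ec Z \<Longrightarrow> n Z + n (X - Z) = C" using u by (auto simp: uniform_bd_def)
  have ecA: "ec (\<Union>A)" using ec_Union_edges[OF A] .
  have "bd_count (partial_dual G A) Z + bd_count (partial_dual G A) (flags (partial_dual G A) - Z) = C"
    if "edge_closed (partial_dual G A) Z" for Z
  proof -
    have Z: "ec Z"
      using that unfolding edge_closed_def partial_dual_def by (auto split: if_splits)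
    have "sym_diff (\<Union>A) (X - Z) = X - sym_diff (\<Union>A) Z"
      using ec_subset[OF ecA] ec_subset[OF Z] by blast
    moreover have "ec (sym_diff (\<Union>A) Z)" using ec_Un ec_Diff ecA Z by simp
    moreover have "flags (partial_dual G A) = X" by (simp add: partial_dual_def)
    ultimately show ?thesis unfolding bd_count_partial_dual using C by simp
  qed
  then show ?thesis unfolding uniform_bd_def by blast
qed

end

lemma uniform_bd_iso:
  assumes G: "is_ribbon_graph G" and f: "iso_by f G H" and u: "uniform_bd H"
  shows "uniform_bd G"
proof -
  obtain C where C: "\<And>Z. edge_closed H Z \<Longrightarrow> bd_count H Z + bd_count H (flags H - Z) = C"
    using u by (auto simp: uniform_bd_def)
  have bij: "bij_betw f (flags G) (flags H)" using f by (simp add: iso_by_def)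
  have "bd_count G Z + bd_count G (flags G - Z) = C" if Z: "edge_closed G Z" for Z
  proof -
    have ZG: "Z \<subseteq> flags G" using Z by (simp add: edge_closed_def)
    have "f ` (flags G - Z) = flags H - f ` Z"
      using bij ZG inj_on_image_set_diff[of f "flags G" "flags G" Z] by (auto simp: bij_betw_def)
    moreover have "edge_closed H (f ` Z)"
    proof (rule edge_closedI)
      show "f ` Z \<subseteq> flags H" using bij ZG by (auto simp: bij_betw_def)
    next
      fix w assume "w \<in> f ` Z"
      then obtain z where z: "z \<in> Z" "w = f z" by auto
      then have "tau_end H w = f (tau_end G z)" "tau_side H w = f (tau_side G z)"
        using f ZG by (auto simp: iso_by_def)
      then show "tau_end H w \<in> f ` Z" "tau_side H w \<in> f ` Z"
        using z Z by (auto simp: edge_closed_def)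
    qed
    ultimately show ?thesis
      using C[of "f ` Z"] bd_count_iso[OF G f ZG] bd_count_iso[OF G f, of "flags G - Z"] by simp
  qed
  then show ?thesis unfolding uniform_bd_def by blast
qed

theorem mainTheorem2:
  fixes G :: "'a ribbon_graph"
  assumes "is_ribbon_graph G" and "connected_rg G" and "orientable_rg G"
    and nonconstant: "degree (partial_dual_genus_poly G) > 0"
  shows "(\<exists>!k. coeff (partial_dual_genus_poly G) k \<noteq> 0) \<longleftrightarrow>
    (\<exists>(H :: 'a ribbon_graph) A. H \<in> ribbon_joins_of {K. \<exists>n. odd n \<and> is_B n K} \<and>
           A \<subseteq> edges H \<and> G \<cong>\<^sub>r partial_dual H A)"
proof -
  let ?J = "ribbon_joins_of {K :: 'a ribbon_graph. \<exists>n. odd n \<and> is_B n K}"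
  obtain c where "oriented_rg G c"
    using assms(1,3) unfolding orientable_rg_def oriented_rg_def by blast
  then interpret oriented_rg G c .
  show ?thesis
  proof
    assume "\<exists>!k. coeff (partial_dual_genus_poly G) k \<noteq> 0"
    then obtain k where k: "\<And>A. A \<subseteq> edges G \<Longrightarrow> genus (partial_dual G A) = k"
      using single_coeff_iff[OF finite_edges] by auto
    \<comment> \<open>The leading coefficient is non-zero, so the degree itself occurs as a genus;
      this makes \<open>k\<close> positive.\<close>
    have "partial_dual_genus_poly G \<noteq> 0" using nonconstant by auto
    then have "coeff (partial_dual_genus_poly G) (degree (partial_dual_genus_poly G)) \<noteq> 0" by simp
    then have "card {A \<in> Pow (edges G). genus (partial_dual G A) = degree (partial_dual_genus_poly G)} \<noteq> 0"
      unfolding coeff_partial_dual_genus_poly[OF finite_edges] by simp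
    then obtain A where "A \<subseteq> edges G" "genus (partial_dual G A) = degree (partial_dual_genus_poly G)"
      by (metis (mono_tags, lifting) PowD card.empty empty_Collect_eq)
    then have kpos: "k > 0" using k[of A] nonconstant by simp
    have u: "uniform_bd G" using uniform_bd_if_genus_constant[OF k kpos] .
    have ne: "X \<noteq> {}"
    proof
      assume X: "X = {}"
      then have "edges G = {}" by (simp add: edges_eq)
      moreover have "num_components G = isolated G"
        by (simp add: num_components_def orbits_def X quotient_def)
      moreover have "bd_sum G {} = 0" by (simp add: bd_sum_def bd_count_def X quotient_def)
      ultimately have "genus (partial_dual G {}) = 0" by (simp add: genus_partial_dual)
      then show False using k[of "{}"] kpos by simp
    qed
    have iso: "isolated G = 0" using connected_flags(1)[OF assms(2) ne] .
    obtain Z where Z: "ec Z" "n Z = 1" using ex_one_vertex_partial_dual[OF assms(2) ne] .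
    obtain A where A: "A \<subseteq> edges G" "Z = \<Union>A"
      by (rule that[of "{e \<in> edges G. e \<subseteq> Z}"]) (blast, rule edge_closed_eq_Union[OF Z(1)])
    let ?G = "partial_dual G A"
    have "bouquet ?G c"
      using oriented_rg_partial_dual[OF A(1)] ne Z(2) A(2)
      unfolding bouquet_def bouquet_axioms_def bd_count_partial_dual by (simp add: partial_dual_def)
    moreover have "isolated ?G = 0" using iso by (simp add: partial_dual_def)
    ultimately obtain H where H: "H \<in> ?J" "same_on_flags H ?G"
      using uniform_bouquet_is_join uniform_partial_dual[OF u A(1)] by blast
    have "A \<subseteq> edges H" using same_on_flags_edges[OF H(2)] A(1) by (simp add: edges_partial_dual)
    \<comment> \<open>On the flags \<open>H\<close> is the dual of \<open>G\<close> at
      \<open>A\<close>; dualising at \<open>A\<close> once more restores \<open>G\<close>, with the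
      identity as isomorphism.\<close>
    moreover have "G \<cong>\<^sub>r partial_dual H A"
      unfolding ribbon_iso_def
    proof (intro conjI exI[of _ id] ballI)
      have fl: "flags H = X" "isolated H = isolated G"
        using H(2) by (simp_all add: same_on_flags_def partial_dual_def)
      then show "isolated G = isolated (partial_dual H A)"
        "bij_betw id X (flags (partial_dual H A))" by (simp_all add: partial_dual_def)
      fix x assume "x \<in> X"
      then have "tau_end H x = tau_end ?G x" "tau_side H x = tau_side ?G x" "tau_arc H x = tau_arc ?G x"
        using H(2) by (simp_all add: same_on_flags_def partial_dual_def)
      then show "id (\<epsilon> x) = tau_end (partial_dual H A) (id x)"
        "id (\<sigma> x) = tau_side (partial_dual H A) (id x)"
        "id (\<alpha> x) = tau_arc (partial_dual H A) (id x)"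
        by (simp_all add: partial_dual_def)
    qed
    ultimately show "\<exists>(H :: 'a ribbon_graph) A. H \<in> ?J \<and> A \<subseteq> edges H \<and> G \<cong>\<^sub>r partial_dual H A"
      using H(1) by blast
  next
    assume "\<exists>(H :: 'a ribbon_graph) A. H \<in> ?J \<and> A \<subseteq> edges H \<and> G \<cong>\<^sub>r partial_dual H A"
    then obtain H :: "'a ribbon_graph" and A
      where H: "H \<in> ?J" "A \<subseteq> edges H" "G \<cong>\<^sub>r partial_dual H A" by blast
    obtain f where f: "iso_by f G (partial_dual H A)"
      using H(3) unfolding ribbon_iso_def iso_by_def by blast
    obtain d where "oriented_rg H d"
      using ribbon_joins_uniform[OF H(1)] unfolding orientable_rg_def oriented_rg_def by blast
    then have "uniform_bd (partial_dual H A)"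
      using oriented_rg.uniform_partial_dual ribbon_joins_uniform[OF H(1)] H(2) by blast
    then have "uniform_bd G" using uniform_bd_iso[OF rg f] by blast
    then show "\<exists>!k. coeff (partial_dual_genus_poly G) k \<noteq> 0"
      using genus_constant_if_uniform_bd single_coeff_iff[OF finite_edges] by blast
  qed
qed

end
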